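(* Let $U_-<U_+$ be real numbers, $U=[U_-,U_+]$, and let $b\in C^3(U)$ satisfy $b^*\ge b(u)\ge b_*>0$ for all $u\in U$, with constants $b^*,b_*$. Let $\ell\ge 1$ be a fixed integer, $\alpha>0$ and $c\ge 1$ constants. For $0<\varepsilon\ll 1$ let $u_\varepsilon$ be the solution, with values in $U$, of $$\varepsilon^2u''+x\,b(u)\,u'=0,\quad x\in[0,1],\qquad u(0)=U_-,\ u(1)=U_+,$$ let $u_\varepsilon^h=[u_\varepsilon(x_1),\ldots,u_\varepsilon(x_{N-1})]^T$ be its restriction to the interior points of the S($\ell$) mesh with $\lambda=1/\varepsilon$ (see context), and let $w_\varepsilon^h\in W$ be the solution of the discrete problem $Tw^h=0$ on this mesh (see context). Then there exist $\varepsilon_0\in(0,1)$ and $M>0$, depending only on $b,U_-,U_+,b_*,b^*,\alpha,\ell,c$ (in particular $M$ is independent of $\varepsilon$ and $N$), such that for all $\varepsilon\in(0,\varepsilon_0]$ and all such meshes $$\|w_\varepsilon^h-u_\varepsilon^h\|_H\le M\delta,\qquad \delta=\varepsilon\left(\frac{\ln^{\ell}(1/\varepsilon)}{N}\right)^2 ,$$ where $\ln^\ell$ denotes the $\ell$-fold iterated logarithm.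
   Context: **Continuous solution.** $u_\varepsilon\in C^2([0,1])$ is the unique solution of the boundary value problem satisfying $u_\varepsilon(x)\in U$ for all $x\in[0,1]$. **S($\ell$) mesh.** Let $\ln^0\lambda=\lambda$, $\ln^k\lambda=\ln(\ln^{k-1}\lambda)$ (iterated logarithm, not a power), $k=1,\ldots,K$, where $K=K(\lambda)$ is the positive integer with $0<\ln^K\lambda<1$; it is assumed that $1\le\ell\le K$. The transition points are $\tau_k=\alpha\varepsilon\ln^{\ell-k+1}\lambda$, $k=1,\ldots,\ell$, with $\tau_\ell<1$ assumed; put $\tau_0=0$, $\tau_{\ell+1}=1$. Each interval $I_k=[\tau_{k-1},\tau_k]$, $k=1,\ldots,\ell+1$, is divided into $N_k\ge2$ equal subintervals, where $N_1+\cdots+N_{\ell+1}=N$ and $N\le cN_k$ for every $k$, with $c$ independent of $\varepsilon$ and $N$. The resulting points $0=x_0<x_1<\cdots<x_N=1$ form the mesh. Let $h_i=x_i-x_{i-1}$; the meshes satisfy $h_i\le h_{i+1}$, $i=1,\ldots,N-1$. Here $\lambda=1/\varepsilon$. **Discrete problem.** Let $\hbar_i=(h_i+h_{i+1})/2$. Mesh functions $w^h=[w_1,\ldots,w_{N-1}]^T\in\mathbb R^{N-1}$ are extended by $w_0=U_-$, $w_N=U_+$, and $W=\{w^h\in\mathbb R^{N-1}: w_i\in U,\ i=1,\ldots,N-1\}$. Let $\rho_i=b^*x_{i-1}h_i/(2\varepsilon^2)$ and $n=\max\{i\in\{1,\ldots,N-1\}:\rho_i\le1\}$ (note $\rho_1=0$).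 If $1<n<N-1$, set $\chi_i=\hbar_i$ for $1\le i\le n-1$, $\chi_n=h_n/2+h_{n+1}$, $\chi_i=h_{i+1}$ for $n+1\le i\le N-1$. If $n=1$, set $\chi_i=h_{i+1}$ for all $i$; if $n=N-1$, set $\chi_i=\hbar_i$ for all $i$. Let $f(x,u)=x\int_{U_+}^u b(t)\,dt$, $f_x(x,u)=\int_{U_+}^u b(t)\,dt$, $f_i=f(x_i,w_i)$, $f_{x,i}=f_x(x_i,w_i)$, and $$D''w_i=\frac1{\chi_i}\left(\frac{w_{i-1}-w_i}{h_i}+\frac{w_{i+1}-w_i}{h_{i+1}}\right),$$ $$T_cw_i=-\varepsilon^2D''w_i-\frac{f_{i+1}-f_{i-1}}{2\hbar_i}+f_{x,i},$$ $$T_+w_i=-\varepsilon^2D''w_i-\frac{f_{i+1}-f_i}{h_{i+1}}+\frac{f_{x,i+1}+f_{x,i}}2,$$ $$T_tw_i=-\varepsilon^2D''w_i-\frac{2f_{i+1}-f_i-f_{i-1}}{2\chi_i}+f_{x,i}.$$ If $1<n<N-1$: $(Tw^h)_i=T_cw_i$ for $1\le i\le n-1$, $(Tw^h)_n=T_tw_n$, $(Tw^h)_i=T_+w_i$ for $n+1\le i\le N-1$. If $n=1$, $T=T_+$ at all $i$; if $n=N-1$, $T=T_c$ at all $i$. The discrete problem is $Tw^h=0$. **Norm.** $\|w^h\|_H=\sum_{i=1}^{N-1}\chi_i|w_i|$. *)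

theory Defs
  imports "HOL-Analysis.Analysis"
begin

text \<open>Classes $C^k(S)$, mainly for closed intervals: derivatives are taken within \<open>S\<close>, hence
  one-sided at the endpoints.\<close>

fun Ck_on :: "nat \<Rightarrow> (real \<Rightarrow> real) \<Rightarrow> real set \<Rightarrow> bool" where
  "Ck_on 0 g S \<longleftrightarrow> continuous_on S g"
| "Ck_on (Suc k) g S \<longleftrightarrow>
     (\<exists>g'. (\<forall>x\<in>S. (g has_real_derivative g' x) (at x within S)) \<and> Ck_on k g' S)"

text \<open>Solutions \<open>u\<close> in $C^2([0,1])$, with values in \<open>{Um..Up}\<close>, of
  \<open>eps\<^sup>2 u'' + x b(u) u' = 0\<close>, \<open>u(0) = Um\<close>, \<open>u(1) = Up\<close>.\<close>

definition bvp_solution ::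
  "(real \<Rightarrow> real) \<Rightarrow> real \<Rightarrow> real \<Rightarrow> real \<Rightarrow> (real \<Rightarrow> real) \<Rightarrow> bool" where
  "bvp_solution b Um Up eps u \<longleftrightarrow>
     (\<exists>u' u''.
        (\<forall>x\<in>{0..1}. (u has_real_derivative u' x) (at x within {0..1})) \<and>
        (\<forall>x\<in>{0..1}. (u' has_real_derivative u'' x) (at x within {0..1})) \<and>
        continuous_on {0..1} u'' \<and>
        (\<forall>x\<in>{0..1}. eps\<^sup>2 * u'' x + x * b (u x) * u' x = 0)) \<and>
     u 0 = Um \<and> u 1 = Up \<and> (\<forall>x\<in>{0..1}. u x \<in> {Um..Up})"

definition iter_ln :: "nat \<Rightarrow> real \<Rightarrow> real" where
  "iter_ln k lam = ((ln :: real \<Rightarrow> real) ^^ k) lam"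

text \<open>\<open>is_log_depth lam K\<close> says that \<open>K\<close> is the positive integer with
  \<open>0 < iter_ln K lam < 1\<close>. Since \<^const>\<open>ln\<close> is total on the reals (\<open>ln (- x) = ln x\<close>), iterating
  beyond a negative value could return to \<open>(0,1)\<close>; the first clause on the iterates rules this out
  by demanding that all the logarithms be taken of positive numbers, which makes \<open>K\<close> unique.\<close>

definition is_log_depth :: "real \<Rightarrow> nat \<Rightarrow> bool" where
  "is_log_depth lam K \<longleftrightarrow>
     1 \<le> K \<and> (\<forall>j<K. 0 < iter_ln j lam) \<and> 0 < iter_ln K lam \<and> iter_ln K lam < 1"

definition transition_pt :: "real \<Rightarrow> nat \<Rightarrow> real \<Rightarrow> nat \<Rightarrow> real" where
  "transition_pt \<alpha> l eps k =
     (if k = 0 then 0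
      else if k \<le> l then \<alpha> * eps * iter_ln (l - k + 1) (1 / eps)
      else 1)"

definition step :: "(nat \<Rightarrow> real) \<Rightarrow> nat \<Rightarrow> real" where
  "step x i = x i - x (i - 1)"

definition avg_step :: "(nat \<Rightarrow> real) \<Rightarrow> nat \<Rightarrow> real" where
  "avg_step x i = (step x i + step x (i + 1)) / 2"

text \<open>\<open>Nk k\<close> is the number of subintervals of the \<open>k\<close>-th interval, \<open>1 \<le> k \<le> l + 1\<close>. Only the values
  \<open>x 0, \<dots>, x N\<close> of the mesh function \<open>x\<close> are relevant.\<close>

definition S_mesh ::
  "real \<Rightarrow> nat \<Rightarrow> real \<Rightarrow> real \<Rightarrow> nat \<Rightarrow> (nat \<Rightarrow> nat) \<Rightarrow> (nat \<Rightarrow> real) \<Rightarrow> bool" where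
  "S_mesh \<alpha> l c eps N Nk x \<longleftrightarrow>
     (\<exists>K. is_log_depth (1 / eps) K \<and> 1 \<le> l \<and> l \<le> K) \<and>
     transition_pt \<alpha> l eps l < 1 \<and>
     (\<forall>k\<in>{1..l+1}. 2 \<le> Nk k) \<and>
     (\<Sum>k=1..l+1. Nk k) = N \<and>
     (\<forall>k\<in>{1..l+1}. real N \<le> c * real (Nk k)) \<and>
     (\<forall>k\<in>{1..l+1}. \<forall>j\<in>{0..Nk k}.
        x ((\<Sum>m\<in>{1..<k}. Nk m) + j) =
          transition_pt \<alpha> l eps (k - 1) +
          real j * ((transition_pt \<alpha> l eps k - transition_pt \<alpha> l eps (k - 1)) / real (Nk k))) \<and>
     (\<forall>i\<in>{1..N-1}. step x i \<le> step x (i + 1))"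

text \<open>In the following, \<open>bmax\<close> is the given upper bound $b^*$ of \<open>b\<close>.\<close>

definition rho :: "real \<Rightarrow> real \<Rightarrow> (nat \<Rightarrow> real) \<Rightarrow> nat \<Rightarrow> real" where
  "rho bmax eps x i = bmax * x (i - 1) * step x i / (2 * eps\<^sup>2)"

definition switch_index :: "real \<Rightarrow> real \<Rightarrow> nat \<Rightarrow> (nat \<Rightarrow> real) \<Rightarrow> nat" where
  "switch_index bmax eps N x = Max {i \<in> {1..N-1}. rho bmax eps x i \<le> 1}"

definition chi :: "real \<Rightarrow> real \<Rightarrow> nat \<Rightarrow> (nat \<Rightarrow> real) \<Rightarrow> nat \<Rightarrow> real" where
  "chi bmax eps N x i =
     (let n = switch_index bmax eps N x in
      if n = 1 then step x (i + 1)
      else if n = N - 1 then avg_step x i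
      else if i < n then avg_step x i
      else if i = n then step x n / 2 + step x (n + 1)
      else step x (i + 1))"

text \<open>Mesh functions are maps \<open>w :: nat \<Rightarrow> real\<close> of which only the values at \<open>1, \<dots>, N - 1\<close> matter;
  \<open>extend_bc\<close> adds the boundary values.\<close>

definition extend_bc :: "real \<Rightarrow> real \<Rightarrow> nat \<Rightarrow> (nat \<Rightarrow> real) \<Rightarrow> nat \<Rightarrow> real" where
  "extend_bc Um Up N w i = (if i = 0 then Um else if i = N then Up else w i)"

text \<open>The interval integral is oriented: for \<open>u \<le> Up\<close> it is minus the integral over \<open>[u,Up]\<close>.\<close>

definition flux_x :: "(real \<Rightarrow> real) \<Rightarrow> real \<Rightarrow> real \<Rightarrow> real" where
  "flux_x b Up u = (LBINT t=ereal Up..ereal u. b t)"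

definition flux :: "(real \<Rightarrow> real) \<Rightarrow> real \<Rightarrow> real \<Rightarrow> real \<Rightarrow> real" where
  "flux b Up x u = x * flux_x b Up u"

text \<open>In \<open>D2\<close>, \<open>T_c\<close>, \<open>T_plus\<close> and \<open>T_t\<close> the argument \<open>w\<close> is a mesh function already extended by
  its boundary values, and \<open>ch\<close> stands for the weights \<^const>\<open>chi\<close>.\<close>

definition D2 :: "(nat \<Rightarrow> real) \<Rightarrow> (nat \<Rightarrow> real) \<Rightarrow> (nat \<Rightarrow> real) \<Rightarrow> nat \<Rightarrow> real" where
  "D2 ch x w i =
     1 / ch i * ((w (i - 1) - w i) / step x i + (w (i + 1) - w i) / step x (i + 1))"

definition T_c :: "(real \<Rightarrow> real) \<Rightarrow> real \<Rightarrow> real \<Rightarrow> (nat \<Rightarrow> real) \<Rightarrow> (nat \<Rightarrow> real) \<Rightarrow> (nat \<Rightarrow> real)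
    \<Rightarrow> nat \<Rightarrow> real" where
  "T_c b Up eps ch x w i =
     - eps\<^sup>2 * D2 ch x w i
     - (flux b Up (x (i + 1)) (w (i + 1)) - flux b Up (x (i - 1)) (w (i - 1))) / (2 * avg_step x i)
     + flux_x b Up (w i)"

definition T_plus :: "(real \<Rightarrow> real) \<Rightarrow> real \<Rightarrow> real \<Rightarrow> (nat \<Rightarrow> real) \<Rightarrow> (nat \<Rightarrow> real) \<Rightarrow> (nat \<Rightarrow> real)
    \<Rightarrow> nat \<Rightarrow> real" where
  "T_plus b Up eps ch x w i =
     - eps\<^sup>2 * D2 ch x w i
     - (flux b Up (x (i + 1)) (w (i + 1)) - flux b Up (x i) (w i)) / step x (i + 1)
     + (flux_x b Up (w (i + 1)) + flux_x b Up (w i)) / 2"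

definition T_t :: "(real \<Rightarrow> real) \<Rightarrow> real \<Rightarrow> real \<Rightarrow> (nat \<Rightarrow> real) \<Rightarrow> (nat \<Rightarrow> real) \<Rightarrow> (nat \<Rightarrow> real)
    \<Rightarrow> nat \<Rightarrow> real" where
  "T_t b Up eps ch x w i =
     - eps\<^sup>2 * D2 ch x w i
     - (2 * flux b Up (x (i + 1)) (w (i + 1)) - flux b Up (x i) (w i)
          - flux b Up (x (i - 1)) (w (i - 1))) / (2 * ch i)
     + flux_x b Up (w i)"

definition T_op :: "(real \<Rightarrow> real) \<Rightarrow> real \<Rightarrow> real \<Rightarrow> real \<Rightarrow> real \<Rightarrow> nat \<Rightarrow> (nat \<Rightarrow> real)
    \<Rightarrow> (nat \<Rightarrow> real) \<Rightarrow> nat \<Rightarrow> real" where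
  "T_op b bmax Um Up eps N x w i =
     (let n = switch_index bmax eps N x;
          ch = chi bmax eps N x;
          v = extend_bc Um Up N w in
      if n = 1 then T_plus b Up eps ch x v i
      else if n = N - 1 then T_c b Up eps ch x v i
      else if i < n then T_c b Up eps ch x v i
      else if i = n then T_t b Up eps ch x v i
      else T_plus b Up eps ch x v i)"

definition discrete_solution :: "(real \<Rightarrow> real) \<Rightarrow> real \<Rightarrow> real \<Rightarrow> real \<Rightarrow> real \<Rightarrow> nat
    \<Rightarrow> (nat \<Rightarrow> real) \<Rightarrow> (nat \<Rightarrow> real) \<Rightarrow> bool" where
  "discrete_solution b bmax Um Up eps N x w \<longleftrightarrow>
     (\<forall>i\<in>{1..N-1}. w i \<in> {Um..Up}) \<and>
     (\<forall>i\<in>{1..N-1}. T_op b bmax Um Up eps N x w i = 0)"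

definition H_norm :: "real \<Rightarrow> real \<Rightarrow> nat \<Rightarrow> (nat \<Rightarrow> real) \<Rightarrow> (nat \<Rightarrow> real) \<Rightarrow> real" where
  "H_norm bmax eps N x w = (\<Sum>i=1..N-1. chi bmax eps N x i * \<bar>w i\<bar>)"

end

theory Submission
  imports Defs
begin

text \<open>The derivative of the continuous solution is bounded by \<open>C / eps * exp (- bmin * x\<^sup>2 / (2 * eps\<^sup>2))\<close>,
  and each further derivative costs a factor \<open>1 / eps\<close> and a power of \<open>1 + x / eps\<close>.
  On the discrete side, the three schemes are one conservative scheme with a
  numerical flux per mesh interval (central or upwind), and multiplying the difference of two mesh
  functions by its sign and telescoping the fluxes gives stability in the weighted $L^1$ norm. The
  truncation error is of second order where the central flux is used; where the upwind flux is
  used it loses powers of \<open>h / eps\<close>, but there \<open>2 * eps\<^sup>2 \<le> bmax * x * h\<close>, so the loss is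
  compensated by powers of \<open>x / eps\<close>, which the Gaussian absorbs. On the k-th mesh interval, \<open>k \<ge> 2\<close>,
  the step is of order \<open>eps * y / N\<close> and the Gaussian is at most \<open>exp (- const * (ln y)\<^sup>2)\<close>, where \<open>y\<close> is
  an iterated logarithm of \<open>1 / eps\<close>; this beats any power of \<open>y\<close>, so only the first interval
  contributes the factor \<open>(iter_ln l (1 / eps))\<^sup>2\<close>.\<close>

subsection \<open>Taylor remainders\<close>

text \<open>No relation between \<open>N\<close> and \<open>eps\<close> is assumed, so
  \<open>s = h / eps\<close> may be large even in the first block; this shapes the estimates. If the
  two steps at a node agree, Taylor bounds give a row residual of at most a constant times
  \<open>eps * s^3 * (1 + x / eps)^6\<close>, taken at the right end of the stencil, times the
  Gaussian at its left end. A unit of \<open>x / eps\<close> contains about \<open>1 / s\<close>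
  such rows, so their sum is of order \<open>eps * s^2\<close>. A row between two blocks only has
  \<open>eps * s^2\<close>, but there is just one per transition point. The row at
  \<open>x 1\<close> is the exception: its stencil starts at 0, where the Gaussian equals 1, and the
  polynomial factor is unbounded for large \<open>s\<close>. If \<open>eps <= h 1\<close>, it is
  therefore bounded without higher derivatives, from the a priori estimate
  \<open>x * |F (u x)| = O(eps)\<close>. Smallness of \<open>eps\<close> serves to ensure
  \<open>1 <= iter_ln l (1 / eps)\<close>: the mesh itself also admits an iterated logarithm in
  \<open>(0,1)\<close>, for which powers of \<open>y\<close> could not be compared.\<close>

lemma abs_le_power_Suc_of_deriv:
  fixes f f' :: "real \<Rightarrow> real"
  assumes "\<And>s. s \<in> {0..h} \<Longrightarrow> (f has_real_derivative f' s) (at s within {0..h})"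
    and "\<And>s. s \<in> {0..h} \<Longrightarrow> \<bar>f' s\<bar> \<le> C * s ^ k"
    and "f 0 = 0" "0 \<le> C" "t \<in> {0..h}"
  shows "\<bar>f t\<bar> \<le> C * t ^ Suc k"
proof -
  have "norm (f t - f 0) \<le> C * t ^ k * norm (t - 0)"
  proof (rule field_differentiable_bound[of "{0..t}"])
    fix s assume s: "s \<in> {0..t}"
    show "(f has_field_derivative f' s) (at s within {0..t})"
      by (rule has_field_derivative_subset[OF assms(1)]) (use s assms(5) in auto)
    have "\<bar>f' s\<bar> \<le> C * s ^ k" using assms(2)[of s] assms(5) s by simp
    also have "\<dots> \<le> C * t ^ k" using s assms(4) by (intro mult_left_mono power_mono) simp_all
    finally show "norm (f' s) \<le> C * t ^ k" by simp
  qed (use assms(5) in auto)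
  then show ?thesis using assms(3,5) by (simp add: algebra_simps)
qed

text \<open>Remainders below are functions of the distance \<open>t\<close> to an end or to the
  midpoint of an interval, so \<open>r\<close> is 1 or -1. Derivatives are taken within sets because
  they are one-sided at the ends of \<open>[0,1]\<close>.\<close>

lemma has_real_derivative_affine:
  fixes f f' :: "real \<Rightarrow> real"
  assumes "\<And>s. s \<in> I \<Longrightarrow> (f has_real_derivative f' s) (at s within I)"
    and "\<And>t. t \<in> J \<Longrightarrow> x + r * t \<in> I" and "t \<in> J"
  shows "((\<lambda>t. f (x + r * t)) has_real_derivative f' (x + r * t) * r) (at t within J)"
proof -
  have "(f has_real_derivative f' (x + r * t)) (at (x + r * t) within (\<lambda>t. x + r * t) ` J)"
    by (rule has_field_derivative_subset[OF assms(1)]) (use assms(2,3) in auto)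
  moreover have "((\<lambda>t. x + r * t) has_real_derivative r) (at t within J)"
    by (auto intro!: derivative_eq_intros)
  ultimately show ?thesis
    using DERIV_image_chain[of f _ "\<lambda>t. x + r * t" t J r] by (simp add: o_def)
qed

lemma has_real_derivative_shift:
  fixes f f' :: "real \<Rightarrow> real"
  assumes "\<And>s. s \<in> {a..b} \<Longrightarrow> (f has_real_derivative f' s) (at s within {a..b})"
    and "a \<le> x" "x + h \<le> b" "t \<in> {0..h}"
  shows "((\<lambda>t. f (x + t)) has_real_derivative f' (x + t)) (at t within {0..h})"
  using has_real_derivative_affine[of "{a..b}" f f' "{0..h}" x 1 t] assms by simp

lemma has_real_derivative_reflect:
  fixes f f' :: "real \<Rightarrow> real"
  assumes "\<And>s. s \<in> {a..b} \<Longrightarrow> (f has_real_derivative f' s) (at s within {a..b})"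
    and "a \<le> x - h" "x \<le> b" "t \<in> {0..h}"
  shows "((\<lambda>t. f (x - t)) has_real_derivative - f' (x - t)) (at t within {0..h})"
  using has_real_derivative_affine[of "{a..b}" f f' "{0..h}" x "-1" t] assms by simp

context
  fixes g g1 g2 :: "real \<Rightarrow> real" and a b K h :: real
  assumes g: "\<And>s. s \<in> {a..b} \<Longrightarrow> (g has_real_derivative g1 s) (at s within {a..b})"
    and g1: "\<And>s. s \<in> {a..b} \<Longrightarrow> (g1 has_real_derivative g2 s) (at s within {a..b})"
    and h: "0 \<le> h"
begin

text \<open>Pattern of all remainder bounds here: the remainder, as a function of the step
  \<open>t\<close>, vanishes at \<open>t = 0\<close> together with enough derivatives, and
  \<open>abs_le_power_Suc_of_deriv\<close> is applied from the highest derivative upwards. The mean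
  value theorem yields no factorials, so the constants are not sharp; only the power of
  \<open>h\<close> matters later.\<close>

lemma taylor1_left:
  assumes b: "b = a + h" and K: "\<And>s. s \<in> {a..b} \<Longrightarrow> \<bar>g2 s\<bar> \<le> K"
  shows "\<bar>g b - g a - h * g1 a\<bar> \<le> K * h ^ 2"
proof -
  have K0: "0 \<le> K" using K[of a] b h by simp
  have ds: "((\<lambda>t. g (a + t)) has_real_derivative g1 (a + t)) (at t within {0..h})"
    "((\<lambda>t. g1 (a + t)) has_real_derivative g2 (a + t)) (at t within {0..h})" if "t \<in> {0..h}" for t
    using that b by (auto intro!: has_real_derivative_shift[OF g] has_real_derivative_shift[OF g1])
  have 1: "\<bar>g1 (a + t) - g1 a\<bar> \<le> K * t ^ Suc 0" if t: "t \<in> {0..h}" for t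
  proof (rule abs_le_power_Suc_of_deriv[where h = h and f' = "\<lambda>t. g2 (a + t)"])
    show "((\<lambda>t. g1 (a + t) - g1 a) has_real_derivative g2 (a + s)) (at s within {0..h})"
      if "s \<in> {0..h}" for s by (auto intro!: derivative_eq_intros ds[OF that])
  qed (use t b K0 K in simp_all)
  have "\<bar>g (a + h) - g a - h * g1 a\<bar> \<le> K * h ^ Suc (Suc 0)"
  proof (rule abs_le_power_Suc_of_deriv[where h = h and f' = "\<lambda>t. g1 (a + t) - g1 a"
        and f = "\<lambda>t. g (a + t) - g a - t * g1 a"])
    show "((\<lambda>t. g (a + t) - g a - t * g1 a) has_real_derivative g1 (a + s) - g1 a)
        (at s within {0..h})" if "s \<in> {0..h}" for s
      by (auto intro!: derivative_eq_intros ds[OF that])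
  qed (use h b K0 1 in simp_all)
  then show ?thesis using b by (simp add: power2_eq_square)
qed

lemma taylor1_right:
  assumes b: "b = a + h" and K: "\<And>s. s \<in> {a..b} \<Longrightarrow> \<bar>g2 s\<bar> \<le> K"
  shows "\<bar>g b - g a - h * g1 b\<bar> \<le> K * h ^ 2"
proof -
  have K0: "0 \<le> K" using K[of a] b h by simp
  have ds: "((\<lambda>t. g (b - t)) has_real_derivative - g1 (b - t)) (at t within {0..h})"
    "((\<lambda>t. g1 (b - t)) has_real_derivative - g2 (b - t)) (at t within {0..h})" if "t \<in> {0..h}" for t
    using that b by (auto intro!: has_real_derivative_reflect[OF g] has_real_derivative_reflect[OF g1])
  have 1: "\<bar>g1 b - g1 (b - t)\<bar> \<le> K * t ^ Suc 0" if t: "t \<in> {0..h}" for t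
  proof (rule abs_le_power_Suc_of_deriv[where h = h and f' = "\<lambda>t. g2 (b - t)"])
    show "((\<lambda>t. g1 b - g1 (b - t)) has_real_derivative g2 (b - s)) (at s within {0..h})"
      if "s \<in> {0..h}" for s by (auto intro!: derivative_eq_intros ds[OF that])
  qed (use t b K0 K in simp_all)
  have "\<bar>g (b - h) - g b + h * g1 b\<bar> \<le> K * h ^ Suc (Suc 0)"
  proof (rule abs_le_power_Suc_of_deriv[where h = h and f' = "\<lambda>t. g1 b - g1 (b - t)"
        and f = "\<lambda>t. g (b - t) - g b + t * g1 b"])
    show "((\<lambda>t. g (b - t) - g b + t * g1 b) has_real_derivative g1 b - g1 (b - s))
        (at s within {0..h})" if "s \<in> {0..h}" for s
      by (auto intro!: derivative_eq_intros ds[OF that])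
  qed (use h b K0 1 in simp_all)
  then show ?thesis using b by (simp add: power2_eq_square abs_if split: if_splits)
qed

context
  fixes g3 :: "real \<Rightarrow> real"
  assumes g2: "\<And>s. s \<in> {a..b} \<Longrightarrow> (g2 has_real_derivative g3 s) (at s within {a..b})"
begin

text \<open>Differentiating the remainder twice makes the \<open>g2\<close> terms cancel and leaves
  \<open>- t / 2 * g3 (a + t)\<close>; the factor \<open>t\<close> supplies the third power of
  \<open>h\<close>.\<close>

lemma trapezoid_bound:
  assumes b: "b = a + h" and K: "\<And>s. s \<in> {a..b} \<Longrightarrow> \<bar>g3 s\<bar> \<le> K"
  shows "\<bar>g b - g a - h * (g1 a + g1 b) / 2\<bar> \<le> K * h ^ 3"
proof -
  have K0: "0 \<le> K" using K[of a] b h by simp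
  have ds: "((\<lambda>t. g (a + t)) has_real_derivative g1 (a + t)) (at t within {0..h})"
    "((\<lambda>t. g1 (a + t)) has_real_derivative g2 (a + t)) (at t within {0..h})"
    "((\<lambda>t. g2 (a + t)) has_real_derivative g3 (a + t)) (at t within {0..h})" if "t \<in> {0..h}" for t
    using that b by (auto intro!: has_real_derivative_shift[OF g] has_real_derivative_shift[OF g1]
        has_real_derivative_shift[OF g2])
  have K': "\<bar>- (t / 2 * g3 (a + t))\<bar> \<le> K * t ^ Suc 0" if t: "t \<in> {0..h}" for t
  proof -
    have "\<bar>t * g3 (a + t)\<bar> \<le> t * K"
      using mult_left_mono[OF K[of "a + t"], of t] t b by (simp add: abs_mult)
    moreover have "0 \<le> t * K" using t K0 by simp
    ultimately show ?thesis by (simp add: abs_mult algebra_simps)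
  qed
  have 1: "\<bar>(g1 (a + t) - g1 a) / 2 - t / 2 * g2 (a + t)\<bar> \<le> K * t ^ Suc (Suc 0)"
    if t: "t \<in> {0..h}" for t
  proof (rule abs_le_power_Suc_of_deriv[where h = h and f' = "\<lambda>t. - (t / 2 * g3 (a + t))"])
    show "((\<lambda>t. (g1 (a + t) - g1 a) / 2 - t / 2 * g2 (a + t)) has_real_derivative
        - (s / 2 * g3 (a + s))) (at s within {0..h})" if "s \<in> {0..h}" for s
      by (rule derivative_eq_intros ds[OF that] refl | simp add: field_simps)+
  qed (use t b K0 K' in simp_all)
  have "\<bar>g (a + h) - g a - h * (g1 a + g1 (a + h)) / 2\<bar> \<le> K * h ^ Suc (Suc (Suc 0))"
  proof (rule abs_le_power_Suc_of_deriv[where h = h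
          and f' = "\<lambda>t. (g1 (a + t) - g1 a) / 2 - t / 2 * g2 (a + t)"
          and f = "\<lambda>t. g (a + t) - g a - t * (g1 a + g1 (a + t)) / 2"])
    show "((\<lambda>t. g (a + t) - g a - t * (g1 a + g1 (a + t)) / 2) has_real_derivative
        (g1 (a + s) - g1 a) / 2 - s / 2 * g2 (a + s)) (at s within {0..h})" if "s \<in> {0..h}" for s
      by (rule derivative_eq_intros ds[OF that] refl | simp add: field_simps)+
  qed (use h b K0 1 in simp_all)
  then show ?thesis using b by (simp add: numeral_eq_Suc)
qed

context
  fixes x :: real
  assumes x: "a = x - h" "b = x + h"
begin

private lemma ds:
  assumes "t \<in> {0..h}"
  shows "((\<lambda>t. g (x + t)) has_real_derivative g1 (x + t)) (at t within {0..h})"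
    "((\<lambda>t. g1 (x + t)) has_real_derivative g2 (x + t)) (at t within {0..h})"
    "((\<lambda>t. g2 (x + t)) has_real_derivative g3 (x + t)) (at t within {0..h})"
    "((\<lambda>t. g (x - t)) has_real_derivative - g1 (x - t)) (at t within {0..h})"
    "((\<lambda>t. g1 (x - t)) has_real_derivative - g2 (x - t)) (at t within {0..h})"
    "((\<lambda>t. g2 (x - t)) has_real_derivative - g3 (x - t)) (at t within {0..h})"
  using assms x h by (auto intro!: has_real_derivative_shift[OF g] has_real_derivative_shift[OF g1]
        has_real_derivative_shift[OF g2] has_real_derivative_reflect[OF g]
        has_real_derivative_reflect[OF g1] has_real_derivative_reflect[OF g2])

private lemma second_difference_bound:
  assumes K: "\<And>s. s \<in> {a..b} \<Longrightarrow> \<bar>g3 s\<bar> \<le> K" and t: "t \<in> {0..h}"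
  shows "\<bar>g2 (x + t) - g2 (x - t)\<bar> \<le> 2 * K * t ^ Suc 0"
proof (rule abs_le_power_Suc_of_deriv[where h = h and f' = "\<lambda>t. g3 (x + t) + g3 (x - t)"])
  show "((\<lambda>t. g2 (x + t) - g2 (x - t)) has_real_derivative g3 (x + s) + g3 (x - s))
      (at s within {0..h})" if "s \<in> {0..h}" for s
    by (auto intro!: derivative_eq_intros ds[OF that])
  show "\<bar>g3 (x + s) + g3 (x - s)\<bar> \<le> 2 * K * s ^ 0" if "s \<in> {0..h}" for s
    using K[of "x + s"] K[of "x - s"] that x by simp
  show "0 \<le> 2 * K" using K[of x] x h by simp
qed (use t in simp_all)

lemma central_first_bound:
  assumes K: "\<And>s. s \<in> {a..b} \<Longrightarrow> \<bar>g3 s\<bar> \<le> K"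
  shows "\<bar>g b - g a - 2 * h * g1 x\<bar> \<le> 2 * K * h ^ 3"
proof -
  have K0: "0 \<le> K" using K[of x] x h by simp
  have 2: "\<bar>g1 (x + t) + g1 (x - t) - 2 * g1 x\<bar> \<le> 2 * K * t ^ Suc (Suc 0)"
    if t: "t \<in> {0..h}" for t
  proof (rule abs_le_power_Suc_of_deriv[where h = h and f' = "\<lambda>t. g2 (x + t) - g2 (x - t)"])
    show "((\<lambda>t. g1 (x + t) + g1 (x - t) - 2 * g1 x) has_real_derivative g2 (x + s) - g2 (x - s))
        (at s within {0..h})" if "s \<in> {0..h}" for s
      by (auto intro!: derivative_eq_intros ds[OF that])
  qed (use t K0 second_difference_bound[OF K] in simp_all)
  have "\<bar>g (x + h) - g (x - h) - 2 * h * g1 x\<bar> \<le> 2 * K * h ^ Suc (Suc (Suc 0))"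
  proof (rule abs_le_power_Suc_of_deriv[where h = h
          and f' = "\<lambda>t. g1 (x + t) + g1 (x - t) - 2 * g1 x"
          and f = "\<lambda>t. g (x + t) - g (x - t) - 2 * t * g1 x"])
    show "((\<lambda>t. g (x + t) - g (x - t) - 2 * t * g1 x) has_real_derivative
        g1 (x + s) + g1 (x - s) - 2 * g1 x) (at s within {0..h})" if "s \<in> {0..h}" for s
      by (auto intro!: derivative_eq_intros ds[OF that])
  qed (use h K0 2 in simp_all)
  then show ?thesis using x by (simp add: numeral_eq_Suc)
qed

text \<open>After division by \<open>h\<close> this is the difference of the upwind edge errors at a
  node with equal steps: each of them is of first order, their difference of second order.\<close>

lemma forward_second_bound:
  assumes K: "\<And>s. s \<in> {a..b} \<Longrightarrow> \<bar>g3 s\<bar> \<le> K"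
  shows "\<bar>(g b - 2 * g x + g a) - h * (g1 b - g1 x)\<bar> \<le> 3 * K * h ^ 3"
proof -
  have K0: "0 \<le> K" using K[of x] x h by simp
  have 2: "\<bar>g2 (x - t) - g2 (x + t) - t * g3 (x + t)\<bar> \<le> 3 * K * t ^ Suc 0"
    if t: "t \<in> {0..h}" for t
  proof -
    have "\<bar>t * g3 (x + t)\<bar> \<le> t * K"
      using mult_left_mono[OF K[of "x + t"], of t] t x by (simp add: abs_mult)
    then show ?thesis using second_difference_bound[OF K t] by (simp add: algebra_simps)
  qed
  have 3: "\<bar>g1 x - g1 (x - t) - t * g2 (x + t)\<bar> \<le> 3 * K * t ^ Suc (Suc 0)"
    if t: "t \<in> {0..h}" for t
  proof (rule abs_le_power_Suc_of_deriv[where h = h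
          and f' = "\<lambda>t. g2 (x - t) - g2 (x + t) - t * g3 (x + t)"])
    show "((\<lambda>t. g1 x - g1 (x - t) - t * g2 (x + t)) has_real_derivative
        g2 (x - s) - g2 (x + s) - s * g3 (x + s)) (at s within {0..h})" if "s \<in> {0..h}" for s
      by (auto intro!: derivative_eq_intros ds[OF that])
  qed (use t K0 2 in simp_all)
  have "\<bar>(g (x + h) - 2 * g x + g (x - h)) - h * (g1 (x + h) - g1 x)\<bar> \<le> 3 * K * h ^ Suc (Suc (Suc 0))"
  proof (rule abs_le_power_Suc_of_deriv[where h = h
          and f' = "\<lambda>t. g1 x - g1 (x - t) - t * g2 (x + t)"
          and f = "\<lambda>t. (g (x + t) - 2 * g x + g (x - t)) - t * (g1 (x + t) - g1 x)"])
    show "((\<lambda>t. (g (x + t) - 2 * g x + g (x - t)) - t * (g1 (x + t) - g1 x)) has_real_derivative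
        g1 x - g1 (x - s) - s * g2 (x + s)) (at s within {0..h})" if "s \<in> {0..h}" for s
      by (auto intro!: derivative_eq_intros ds[OF that])
  qed (use h K0 3 in simp_all)
  then show ?thesis using x by (simp add: numeral_eq_Suc)
qed

text \<open>By symmetry the second derivative of the remainder is
  \<open>- t / 2 * (g3 (x + t) - g3 (x - t))\<close>, already of order \<open>t^2\<close>. After
  division by \<open>h\<close> this is the difference of the central edge errors at a node with
  equal steps.\<close>

lemma central_second_bound:
  assumes g3: "\<And>s. s \<in> {a..b} \<Longrightarrow> (g3 has_real_derivative g4 s) (at s within {a..b})"
    and K: "\<And>s. s \<in> {a..b} \<Longrightarrow> \<bar>g4 s\<bar> \<le> K"
  shows "\<bar>(g b - 2 * g x + g a) - h * (g1 b - g1 a) / 2\<bar> \<le> K * h ^ 4"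
proof -
  have K0: "0 \<le> K" using K[of x] x h by simp
  have ds3: "((\<lambda>t. g3 (x + t)) has_real_derivative g4 (x + t)) (at t within {0..h})"
    "((\<lambda>t. g3 (x - t)) has_real_derivative - g4 (x - t)) (at t within {0..h})"
    if "t \<in> {0..h}" for t
    using that x h by (auto intro!: has_real_derivative_shift[OF g3] has_real_derivative_reflect[OF g3])
  have 1: "\<bar>g3 (x + t) - g3 (x - t)\<bar> \<le> 2 * K * t ^ Suc 0" if t: "t \<in> {0..h}" for t
  proof (rule abs_le_power_Suc_of_deriv[where h = h and f' = "\<lambda>t. g4 (x + t) + g4 (x - t)"])
    show "((\<lambda>t. g3 (x + t) - g3 (x - t)) has_real_derivative g4 (x + s) + g4 (x - s))
        (at s within {0..h})" if "s \<in> {0..h}" for s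
      by (auto intro!: derivative_eq_intros ds3[OF that])
    show "\<bar>g4 (x + s) + g4 (x - s)\<bar> \<le> 2 * K * s ^ 0" if "s \<in> {0..h}" for s
      using K[of "x + s"] K[of "x - s"] that x by simp
  qed (use t K0 in simp_all)
  have 2: "\<bar>- (t / 2) * (g3 (x + t) - g3 (x - t))\<bar> \<le> K * t ^ 2" if t: "t \<in> {0..h}" for t
  proof -
    have "\<bar>- (t / 2) * (g3 (x + t) - g3 (x - t))\<bar> = t / 2 * \<bar>g3 (x + t) - g3 (x - t)\<bar>"
      using t by (simp add: abs_mult)
    also have "\<dots> \<le> t / 2 * (2 * K * t ^ Suc 0)" using 1[OF t] t by (intro mult_left_mono) simp_all
    finally show ?thesis by (simp add: power2_eq_square algebra_simps)
  qed
  have 3: "\<bar>(g1 (x + t) - g1 (x - t)) / 2 - t / 2 * (g2 (x + t) + g2 (x - t))\<bar> \<le> K * t ^ Suc 2"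
    if t: "t \<in> {0..h}" for t
  proof (rule abs_le_power_Suc_of_deriv[where h = h
          and f' = "\<lambda>t. - (t / 2) * (g3 (x + t) - g3 (x - t))"])
    show "((\<lambda>t. (g1 (x + t) - g1 (x - t)) / 2 - t / 2 * (g2 (x + t) + g2 (x - t)))
        has_real_derivative - (s / 2) * (g3 (x + s) - g3 (x - s))) (at s within {0..h})"
      if "s \<in> {0..h}" for s
      by (rule derivative_eq_intros ds[OF that] refl | simp add: field_simps)+
  qed (use t K0 2 in simp_all)
  have "\<bar>(g (x + h) - 2 * g x + g (x - h)) - h * (g1 (x + h) - g1 (x - h)) / 2\<bar> \<le> K * h ^ Suc (Suc 2)"
  proof (rule abs_le_power_Suc_of_deriv[where h = h
          and f' = "\<lambda>t. (g1 (x + t) - g1 (x - t)) / 2 - t / 2 * (g2 (x + t) + g2 (x - t))"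
          and f = "\<lambda>t. (g (x + t) - 2 * g x + g (x - t)) - t * (g1 (x + t) - g1 (x - t)) / 2"])
    show "((\<lambda>t. (g (x + t) - 2 * g x + g (x - t)) - t * (g1 (x + t) - g1 (x - t)) / 2)
        has_real_derivative (g1 (x + s) - g1 (x - s)) / 2 - s / 2 * (g2 (x + s) + g2 (x - s)))
        (at s within {0..h})" if "s \<in> {0..h}" for s
      by (rule derivative_eq_intros ds[OF that] refl | simp add: field_simps)+
  qed (use h K0 3 in simp_all)
  then show ?thesis using x by (simp add: numeral_eq_Suc)
qed

end

end

end

subsection \<open>Bounds for the continuous solution\<close>

lemma mvt_within:
  fixes f f' :: "real \<Rightarrow> real"
  assumes "\<And>z. z \<in> S \<Longrightarrow> (f has_real_derivative f' z) (at z within S)"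
    and "{x..y} \<subseteq> S" "x \<le> y"
  obtains z where "z \<in> {x..y}" "f y - f x = f' z * (y - x)"
proof -
  have "\<exists>z\<in>{x..y}. f y - f x = (\<lambda>z. (*) (f' z)) z (y - x)"
  proof (rule mvt_very_simple[OF assms(3)])
    show "(f has_derivative (*) (f' z)) (at z within {x..y})" if "x \<le> z" "z \<le> y" for z
      using has_field_derivative_subset[OF assms(1) assms(2), of z] that assms(2)
      by (auto simp: has_field_derivative_def)
  qed
  then show ?thesis using that by auto
qed

text \<open>Since \<open>1 + t <= exp t\<close>, the exponent is at most
  \<open>q * t - m * t^2\<close>, and completing the square gives the bound.\<close>

lemma power_mult_gauss_le:
  fixes t m :: real
  assumes "0 < m" "0 \<le> t"
  shows "(1 + t) ^ q * exp (- (m * t\<^sup>2)) \<le> exp ((real q)\<^sup>2 / (4 * m))"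
proof -
  have "(1 + t) ^ q \<le> exp t ^ q"
    using assms exp_ge_add_one_self[of t] by (intro power_mono) auto
  also have "\<dots> = exp (real q * t)" by (simp add: exp_of_nat_mult)
  finally have "(1 + t) ^ q * exp (- (m * t\<^sup>2)) \<le> exp (real q * t) * exp (- (m * t\<^sup>2))"
    by simp
  also have "\<dots> = exp (real q * t - m * t\<^sup>2)"
    by (simp add: exp_diff exp_minus field_simps)
  also have "real q * t - m * t\<^sup>2 \<le> (real q)\<^sup>2 / (4 * m)"
  proof -
    have "0 \<le> (2 * m * t - real q)\<^sup>2" by simp
    then show ?thesis using assms by (simp add: power2_eq_square field_simps)
  qed
  finally show ?thesis by simp
qed

text \<open>The same square, with \<open>ln y\<close> as variable. This form fits the later blocks,
  where \<open>x / eps\<close> is at least a multiple of \<open>ln y\<close> while the powers to be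
  absorbed are powers of \<open>y\<close>.\<close>

lemma power_mult_gauss_ln_le:
  fixes y m :: real
  assumes "0 < m" "1 \<le> y"
  shows "y ^ q * exp (- (m * (ln y)\<^sup>2)) \<le> exp ((real q)\<^sup>2 / (4 * m))"
proof -
  have "y ^ q = exp (real q * ln y)" using assms by (simp add: exp_of_nat_mult)
  then have "y ^ q * exp (- (m * (ln y)\<^sup>2)) = exp (real q * ln y - m * (ln y)\<^sup>2)"
    by (simp add: exp_diff exp_minus field_simps)
  also have "real q * ln y - m * (ln y)\<^sup>2 \<le> (real q)\<^sup>2 / (4 * m)"
  proof -
    have "0 \<le> (2 * m * ln y - real q)\<^sup>2" by simp
    then show ?thesis using assms by (simp add: power2_eq_square field_simps)
  qed
  finally show ?thesis by simp
qed

text \<open>In the stretched variables \<open>t = x / eps\<close> and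
  \<open>v_k = eps^k u^(k)\<close> the differentiated equation is free of \<open>eps\<close>;
  \<open>e\<close> stands for the Gaussian. \<open>Q = B * C * (1 + t)\<close> dominates the
  coefficients, their products with \<open>t\<close>, and \<open>v1\<close>, so every term is at
  most a fourth power of \<open>Q\<close> times \<open>e\<close>. The 11 counts these terms in
  \<open>v4\<close>: 2 + 2 + 1 + 3 + 3.\<close>

lemma scaled_derivative_bounds:
  fixes t \<beta>0 \<beta>1 \<beta>2 e C B :: real
  assumes \<beta>: "\<bar>\<beta>0\<bar> \<le> B" "\<bar>\<beta>1\<bar> \<le> B" "\<bar>\<beta>2\<bar> \<le> B"
    and "1 \<le> B" "1 \<le> C" "0 \<le> t" "0 \<le> e" "e \<le> 1" and v1: "\<bar>v1\<bar> \<le> C * e"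
    and v2: "v2 = - (t * \<beta>0 * v1)"
    and v3: "v3 = - (\<beta>0 * v1 + t * \<beta>1 * v1\<^sup>2 + t * \<beta>0 * v2)"
    and v4: "v4 = - (2 * \<beta>1 * v1\<^sup>2 + 2 * \<beta>0 * v2 + t * \<beta>2 * v1 ^ 3 + 3 * t * \<beta>1 * v1 * v2
      + t * \<beta>0 * v3)"
  defines "R \<equiv> 11 * (B * C) ^ 4 * (1 + t) ^ 4 * e"
  shows "\<bar>v2\<bar> \<le> R" "\<bar>v3\<bar> \<le> R" "\<bar>v4\<bar> \<le> R" "\<bar>\<beta>0 * v1\<bar> \<le> R" "\<bar>\<beta>1 * v1\<^sup>2 + \<beta>0 * v2\<bar> \<le> R"
proof -
  define Q where "Q = B * C * (1 + t)"
  have BC: "1 * B \<le> B * C" "1 * C \<le> B * C"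
    using assms by (simp_all add: mult_le_cancel_left1 mult_le_cancel_right1)
  have BC_Q: "B * C * 1 \<le> Q" unfolding Q_def using assms by (intro mult_left_mono) auto
  have Q1: "1 \<le> Q" "B \<le> Q" "C \<le> Q" using BC BC_Q assms by linarith+
  have tB: "(1 + t) * B \<le> Q"
  proof -
    have "(1 + t) * B * 1 \<le> (1 + t) * B * C" using assms by (intro mult_left_mono) auto
    then show ?thesis by (simp add: Q_def mult_ac)
  qed
  have b: "\<bar>\<beta>\<bar> \<le> Q" "\<bar>t * \<beta>\<bar> \<le> Q" if "\<bar>\<beta>\<bar> \<le> B" for \<beta>
  proof -
    show "\<bar>\<beta>\<bar> \<le> Q" using that Q1 by linarith
    have "\<bar>t * \<beta>\<bar> \<le> (1 + t) * B" unfolding abs_mult using that assms by (intro mult_mono) auto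
    then show "\<bar>t * \<beta>\<bar> \<le> Q" using tB by linarith
  qed
  have m: "\<bar>x * y\<bar> \<le> X * Y" if "\<bar>x\<bar> \<le> X" "\<bar>y\<bar> \<le> Y" for x y X Y :: real
    unfolding abs_mult using that by (intro mult_mono) auto
  \<comment> \<open>One factor \<open>v1\<close> keeps \<open>e\<close>; further ones are bounded by
    \<open>Q\<close> alone, as \<open>e\<close> is at most 1. Nonlinear terms thus retain one
    Gaussian factor.\<close>
  have w1: "\<bar>v1\<bar> \<le> Q * e" "\<bar>v1\<bar> \<le> Q"
  proof -
    have "C * e \<le> Q * e" using Q1 assms by (intro mult_right_mono) auto
    then show "\<bar>v1\<bar> \<le> Q * e" using v1 by linarith
    moreover have "Q * e \<le> Q * 1" using Q1 assms by (intro mult_left_mono) auto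
    ultimately show "\<bar>v1\<bar> \<le> Q" by linarith
  qed
  have up: "Q ^ i * e \<le> Q ^ j * e" if "i \<le> j" for i j
    using that Q1 assms by (intro mult_right_mono power_increasing) auto
  have p: "\<bar>\<beta>0 * v1\<bar> \<le> Q ^ 2 * e"
    using m[OF b(1)[OF \<beta>(1)] w1(1)] by (simp add: power2_eq_square mult_ac)
  have w2: "\<bar>v2\<bar> \<le> Q ^ 2 * e"
    using m[OF b(2)[OF \<beta>(1)] w1(1)] v2 by (simp add: power2_eq_square mult_ac)
  have w2': "\<bar>\<beta>0 * v2\<bar> \<le> Q ^ 3 * e" "\<bar>t * \<beta>0 * v2\<bar> \<le> Q ^ 3 * e"
    using m[OF b(1)[OF \<beta>(1)] w2] m[OF b(2)[OF \<beta>(1)] w2]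
    by (simp_all add: power2_eq_square power3_eq_cube mult_ac)
  have w11: "\<bar>\<beta>1 * v1\<^sup>2\<bar> \<le> Q ^ 3 * e" "\<bar>t * \<beta>1 * v1\<^sup>2\<bar> \<le> Q ^ 3 * e"
    using m[OF b(1)[OF \<beta>(2)] m[OF w1(2) w1(1)]] m[OF b(2)[OF \<beta>(2)] m[OF w1(2) w1(1)]]
    by (simp_all add: power2_eq_square power3_eq_cube mult_ac)
  have w3: "\<bar>v3\<bar> \<le> 3 * (Q ^ 3 * e)"
    using p w11(2) w2'(2) up[of 2 3] by (simp add: v3 abs_le_iff)
  have w3': "\<bar>t * \<beta>0 * v3\<bar> \<le> 3 * (Q ^ 4 * e)"
    using m[OF b(2)[OF \<beta>(1)] w3] by (simp add: power_numeral_reduce mult_ac)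
  have w111: "\<bar>t * \<beta>2 * v1 ^ 3\<bar> \<le> Q ^ 4 * e"
    using m[OF b(2)[OF \<beta>(3)] m[OF w1(2) m[OF w1(2) w1(1)]]]
    by (simp add: power_numeral_reduce mult_ac)
  have w12: "\<bar>t * \<beta>1 * v1 * v2\<bar> \<le> Q ^ 4 * e"
    using m[OF b(2)[OF \<beta>(2)] m[OF w1(2) w2]] by (simp add: power_numeral_reduce mult_ac)
  have w4: "\<bar>v4\<bar> \<le> 11 * (Q ^ 4 * e)"
  proof -
    have "v4 = - (2 * (\<beta>1 * v1\<^sup>2) + 2 * (\<beta>0 * v2) + t * \<beta>2 * v1 ^ 3 + 3 * (t * \<beta>1 * v1 * v2)
      + t * \<beta>0 * v3)" by (simp add: v4)
    then show ?thesis using w11(1) w2'(1) w3' w111 w12 up[of 3 4] by (simp add: abs_le_iff)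
  qed
  have R: "R = 11 * (Q ^ 4 * e)" by (simp add: R_def Q_def power_mult_distrib)
  have Q0: "0 \<le> Q ^ 4 * e" using Q1 assms by simp
  show "\<bar>v2\<bar> \<le> R" "\<bar>v3\<bar> \<le> R" "\<bar>v4\<bar> \<le> R" "\<bar>\<beta>0 * v1\<bar> \<le> R" "\<bar>\<beta>1 * v1\<^sup>2 + \<beta>0 * v2\<bar> \<le> R"
    using w2 w3 w4 p w11(1) w2'(1) up[of 2 4] up[of 3 4] Q0
    by (simp_all add: R abs_le_iff)
qed

locale layer_problem =
  fixes b b1 b2 :: "real \<Rightarrow> real" and Um Up bmin bmax B :: real
  assumes Um_less_Up: "Um < Up" and bmin_pos: "0 < bmin"
    and b_bounds: "\<And>v. v \<in> {Um..Up} \<Longrightarrow> bmin \<le> b v \<and> b v \<le> bmax"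
    and b_deriv: "\<And>v. v \<in> {Um..Up} \<Longrightarrow> (b has_real_derivative b1 v) (at v within {Um..Up})"
    and b1_deriv: "\<And>v. v \<in> {Um..Up} \<Longrightarrow> (b1 has_real_derivative b2 v) (at v within {Um..Up})"
    and B_ge_1: "1 \<le> B" and bmax_le_B: "bmax \<le> B"
    and b1_bound: "\<And>v. v \<in> {Um..Up} \<Longrightarrow> \<bar>b1 v\<bar> \<le> B"
    and b2_bound: "\<And>v. v \<in> {Um..Up} \<Longrightarrow> \<bar>b2 v\<bar> \<le> B"
begin

abbreviation "F \<equiv> flux_x b Up"

lemma bmax_pos: "0 < bmax"
  using bmin_pos b_bounds[of Um] Um_less_Up by auto

lemma flux_x_deriv:
  assumes "v \<in> {Um..Up}"
  shows "(F has_real_derivative b v) (at v within {Um..Up})"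
proof -
  have "continuous_on {Um..Up} b"
    using b_deriv by (meson DERIV_continuous_on)
  from interval_integral_FTC2[of Um Up Up b v, OF _ _ this]
  show ?thesis
    using assms Um_less_Up
    by (auto simp: flux_x_def[abs_def] has_real_derivative_iff_has_vector_derivative)
qed

lemma flux_x_Up [simp]: "F Up = 0"
  by (simp add: flux_x_def)

lemma flux_x_diff:
  assumes "v \<in> {Um..Up}" "w \<in> {Um..Up}"
  obtains a where "bmin \<le> a" "a \<le> bmax" "F v - F w = a * (v - w)"
proof -
  obtain z where z: "z \<in> {min v w..max v w}"
    "F (max v w) - F (min v w) = b z * (max v w - min v w)"
    by (rule mvt_within[of "{Um..Up}" F b "min v w" "max v w"])
       (use assms flux_x_deriv in \<open>auto\<close>)
  have "F v - F w = b z * (v - w)"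
    using z(2) by (auto simp: max_def min_def algebra_simps split: if_splits)
  moreover have "z \<in> {Um..Up}" using z(1) assms by auto
  ultimately show ?thesis using that b_bounds by blast
qed

text \<open>\<open>C0 / eps\<close> bounds \<open>u1\<close> at 0; \<open>exp (bmax / 2)\<close> is
  the price of moving the estimate from a point of \<open>[0, eps]\<close> back to 0.
  \<open>K0\<close> comes from \<open>scaled_derivative_bounds\<close>, and
  \<open>exp (2 / bmin)\<close> from \<open>power_mult_gauss_le\<close> with \<open>q = 2\<close>,
  \<open>m = bmin / 2\<close>.\<close>

definition "C0 = max 1 ((Up - Um) * exp (bmax / 2))"

definition "K0 = 11 * (B * C0) ^ 4"

definition "C1 = C0 * exp (2 / bmin)"

lemma C0_ge_1: "1 \<le> C0" by (simp add: C0_def)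

lemma C1_ge_1: "1 \<le> C1"
proof -
  have "1 * 1 \<le> C0 * exp (2 / bmin)" using C0_ge_1 bmin_pos by (intro mult_mono) auto
  then show ?thesis by (simp add: C1_def)
qed

lemma K0_ge_1: "1 \<le> K0"
proof -
  have "1 * 1 \<le> B * C0" using B_ge_1 C0_ge_1 by (intro mult_mono) auto
  then have "1 \<le> (B * C0) ^ 4" by (intro one_le_power) simp
  then show ?thesis by (simp add: K0_def)
qed

end

section \<open>A priori bounds and regularity of the continuous solution\<close>

locale layer_solution = layer_problem +
  fixes eps :: real and u u1 u2 :: "real \<Rightarrow> real"
  assumes eps_pos: "0 < eps" and eps_le_1: "eps \<le> 1"
    and u_deriv: "\<And>x. x \<in> {0..1} \<Longrightarrow> (u has_real_derivative u1 x) (at x within {0..1})"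
    and u1_deriv: "\<And>x. x \<in> {0..1} \<Longrightarrow> (u1 has_real_derivative u2 x) (at x within {0..1})"
    and ode: "\<And>x. x \<in> {0..1} \<Longrightarrow> eps\<^sup>2 * u2 x + x * b (u x) * u1 x = 0"
    and u_0: "u 0 = Um" and u_1: "u 1 = Up"
    and u_range: "\<And>x. x \<in> {0..1} \<Longrightarrow> u x \<in> {Um..Up}"
begin

definition "gauss x = exp (- (bmin / 2 * (x / eps)\<^sup>2))"

lemma gauss_pos: "0 < gauss x" and gauss_le_1: "gauss x \<le> 1"
  using bmin_pos by (simp_all add: gauss_def)

lemma gauss_antimono: "0 \<le> x \<Longrightarrow> x \<le> y \<Longrightarrow> gauss y \<le> gauss x"
  using bmin_pos eps_pos by (auto simp: gauss_def intro!: power_mono divide_right_mono)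

lemma u2_eq: "x \<in> {0..1} \<Longrightarrow> u2 x = - (x * b (u x) * u1 x / eps\<^sup>2)"
  using ode[of x] eps_pos by (simp add: field_simps)

text \<open>The weight is the square of the integrating factor of the equation for \<open>u1\<close>
  with \<open>b\<close> frozen at the constant. The product is nonincreasing for \<open>bmin\<close>
  and nondecreasing for \<open>bmax\<close>; squaring \<open>u1\<close> avoids any discussion of its
  sign.\<close>

lemma weighted_deriv:
  fixes \<beta> :: real
  assumes "x \<in> {0..1}"
  shows "((\<lambda>x. (u1 x)\<^sup>2 * exp (\<beta> * (x / eps)\<^sup>2)) has_real_derivative
     2 * x / eps\<^sup>2 * (\<beta> - b (u x)) * ((u1 x)\<^sup>2 * exp (\<beta> * (x / eps)\<^sup>2))) (at x within {0..1})"
  using eps_pos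
  by (auto intro!: derivative_eq_intros u1_deriv[OF assms]
      simp: u2_eq[OF assms] power2_eq_square field_simps)

lemma u1_decay: "x \<in> {0..1} \<Longrightarrow> \<bar>u1 x\<bar> \<le> \<bar>u1 0\<bar> * gauss x"
proof -
  assume x: "x \<in> {0..1}"
  obtain z where z: "z \<in> {0..x}"
    and "(u1 x)\<^sup>2 * exp (bmin * (x / eps)\<^sup>2) - (u1 0)\<^sup>2 * exp (bmin * (0 / eps)\<^sup>2) =
      2 * z / eps\<^sup>2 * (bmin - b (u z)) * ((u1 z)\<^sup>2 * exp (bmin * (z / eps)\<^sup>2)) * (x - 0)"
    by (rule mvt_within[OF weighted_deriv, of 0 x bmin]) (use x in auto)
  moreover have "2 * z / eps\<^sup>2 * (bmin - b (u z)) * ((u1 z)\<^sup>2 * exp (bmin * (z / eps)\<^sup>2)) * (x - 0) \<le> 0"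
    using z x b_bounds[OF u_range, of z]
    by (intro mult_nonpos_nonneg mult_nonneg_nonpos) auto
  ultimately have "(u1 x)\<^sup>2 * exp (bmin * (x / eps)\<^sup>2) \<le> (u1 0)\<^sup>2" by simp
  moreover have "exp (bmin * (x / eps)\<^sup>2) * (gauss x)\<^sup>2 = 1"
    by (simp add: gauss_def power2_eq_square[of "exp _"] flip: exp_add)
  ultimately have "(u1 x)\<^sup>2 \<le> (u1 0)\<^sup>2 * (gauss x)\<^sup>2"
    by (metis (no_types, opaque_lifting) mult.assoc mult.right_neutral mult_right_mono zero_le_power2)
  then have "\<bar>u1 x\<bar> \<le> \<bar>u1 0 * gauss x\<bar>"
    by (metis abs_le_square_iff power_mult_distrib)
  then show ?thesis using gauss_pos[of x] by (simp add: abs_mult)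
qed

text \<open>The mean value theorem on \<open>[0, eps]\<close> provides a point \<open>y\<close> with
  slope at most \<open>(Up - Um) / eps\<close>. The weight with \<open>bmax\<close> carries this
  back to 0, and \<open>y <= eps\<close> keeps the weight bounded.\<close>

lemma u1_0_bound: "\<bar>u1 0\<bar> \<le> C0 / eps"
proof -
  obtain y where y: "y \<in> {0..eps}" "u eps - u 0 = u1 y * (eps - 0)"
    by (rule mvt_within[OF u_deriv, of 0 eps]) (use eps_pos eps_le_1 in auto)
  then have y01: "y \<in> {0..1}" using eps_le_1 by auto
  have "\<bar>u1 y\<bar> * eps = \<bar>u eps - u 0\<bar>" using y eps_pos by (simp add: abs_mult)
  also have "\<dots> \<le> Up - Um" using u_range[of eps] u_0 eps_pos eps_le_1 by auto
  finally have y_bound: "\<bar>u1 y\<bar> \<le> (Up - Um) / eps" using eps_pos by (simp add: field_simps)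
  obtain z where z: "z \<in> {0..y}"
    and "(u1 y)\<^sup>2 * exp (bmax * (y / eps)\<^sup>2) - (u1 0)\<^sup>2 * exp (bmax * (0 / eps)\<^sup>2) =
      2 * z / eps\<^sup>2 * (bmax - b (u z)) * ((u1 z)\<^sup>2 * exp (bmax * (z / eps)\<^sup>2)) * (y - 0)"
    by (rule mvt_within[OF weighted_deriv, of 0 y bmax]) (use y01 in auto)
  moreover have "0 \<le> 2 * z / eps\<^sup>2 * (bmax - b (u z)) * ((u1 z)\<^sup>2 * exp (bmax * (z / eps)\<^sup>2)) * (y - 0)"
    using z y01 b_bounds[OF u_range, of z] by (intro mult_nonneg_nonneg) auto
  ultimately have "(u1 0)\<^sup>2 \<le> (u1 y)\<^sup>2 * exp (bmax * (y / eps)\<^sup>2)" by simp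
  also have "\<dots> \<le> (u1 y)\<^sup>2 * exp (bmax * 1)"
  proof -
    have "(y / eps)\<^sup>2 \<le> 1" using y eps_pos by (intro power_le_one) auto
    then show ?thesis using bmax_pos by (intro mult_left_mono) auto
  qed
  also have "\<dots> = (u1 y * exp (bmax / 2))\<^sup>2"
    by (simp add: power_mult_distrib power2_eq_square[of "exp _"] flip: exp_add)
  finally have "\<bar>u1 0\<bar> \<le> \<bar>u1 y\<bar> * exp (bmax / 2)"
    by (simp add: abs_le_square_iff[symmetric] abs_mult)
  also have "\<dots> \<le> (Up - Um) / eps * exp (bmax / 2)" using y_bound by (intro mult_right_mono) auto
  also have "\<dots> \<le> C0 / eps" using eps_pos by (simp add: C0_def divide_right_mono)
  finally show ?thesis .
qed

lemma u1_bound: "x \<in> {0..1} \<Longrightarrow> \<bar>u1 x\<bar> \<le> C0 / eps * gauss x"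
  using u1_decay[of x] u1_0_bound gauss_pos[of x]
  by (meson less_imp_le mult_right_mono order_trans)

lemma comp_deriv:
  assumes "\<And>v. v \<in> {Um..Up} \<Longrightarrow> (g has_real_derivative g' v) (at v within {Um..Up})"
    and "x \<in> {0..1}"
  shows "((\<lambda>x. g (u x)) has_real_derivative g' (u x) * u1 x) (at x within {0..1})"
proof -
  have "u ` {0..1} \<subseteq> {Um..Up}" using u_range by blast
  then have "(g has_real_derivative g' (u x)) (at (u x) within u ` {0..1})"
    using has_field_derivative_subset[OF assms(1)[OF u_range[OF assms(2)]]] by blast
  from DERIV_image_chain[OF this u_deriv[OF assms(2)]] show ?thesis by (simp add: o_def)
qed

definition "u3 x = - ((b (u x) * u1 x + x * b1 (u x) * (u1 x)\<^sup>2 + x * b (u x) * u2 x) / eps\<^sup>2)"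

definition "u4 x = - ((2 * b1 (u x) * (u1 x)\<^sup>2 + 2 * b (u x) * u2 x + x * b2 (u x) * u1 x ^ 3
   + 3 * x * b1 (u x) * u1 x * u2 x + x * b (u x) * u3 x) / eps\<^sup>2)"

lemma has_real_derivative_cong_on:
  assumes "(g has_real_derivative d) (at x within S)" "\<And>x. x \<in> S \<Longrightarrow> f x = g x" "x \<in> S"
  shows "(f has_real_derivative d) (at x within S)"
  using has_field_derivative_transform_within[OF assms(1), of 1 f] assms(2,3) by simp

text \<open>The solution is only assumed twice differentiable; further regularity is bootstrapped
  from the equation, which expresses \<open>u2\<close> through \<open>x\<close>, \<open>u\<close>
  and \<open>u1\<close>.\<close>

lemma u2_deriv:
  assumes x: "x \<in> {0..1}"
  shows "(u2 has_real_derivative u3 x) (at x within {0..1})"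
proof (rule has_real_derivative_cong_on[OF _ u2_eq x])
  show "((\<lambda>x. - (x * b (u x) * u1 x / eps\<^sup>2)) has_real_derivative u3 x) (at x within {0..1})"
    using eps_pos
    by (auto intro!: derivative_eq_intros u1_deriv[OF x] comp_deriv[OF b_deriv x]
        simp: u3_def power2_eq_square field_simps)
qed

lemma u3_deriv:
  assumes x: "x \<in> {0..1}"
  shows "(u3 has_real_derivative u4 x) (at x within {0..1})"
  unfolding u3_def[abs_def]
  using eps_pos
  by (auto intro!: derivative_eq_intros u1_deriv[OF x] u2_deriv[OF x] comp_deriv[OF b_deriv x]
     comp_deriv[OF b1_deriv x] simp: u4_def power2_eq_square power3_eq_cube field_simps)

text \<open>The equation in divergence form: \<open>G' = F (u x)\<close>, where \<open>G\<close> is the full flux.\<close>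

definition "G x = x * F (u x) + eps\<^sup>2 * u1 x"
definition "G2 x = b (u x) * u1 x"
definition "G3 x = b1 (u x) * (u1 x)\<^sup>2 + b (u x) * u2 x"

lemma G_deriv:
  assumes x: "x \<in> {0..1}"
  shows "(G has_real_derivative F (u x)) (at x within {0..1})"
  unfolding G_def[abs_def]
  using ode[OF x]
  by (auto intro!: derivative_eq_intros u1_deriv[OF x] comp_deriv[OF flux_x_deriv x]
      simp: algebra_simps)

lemma G1_deriv:
  assumes x: "x \<in> {0..1}"
  shows "((\<lambda>x. F (u x)) has_real_derivative G2 x) (at x within {0..1})"
  unfolding G2_def by (rule comp_deriv[OF flux_x_deriv x])

lemma G2_deriv:
  assumes x: "x \<in> {0..1}"
  shows "(G2 has_real_derivative G3 x) (at x within {0..1})"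
  unfolding G2_def[abs_def] G3_def
  by (auto intro!: derivative_eq_intros u1_deriv[OF x] comp_deriv[OF b_deriv x]
      simp: power2_eq_square)


text \<open>An envelope for a whole interval \<open>[a, c]\<close>: the increasing polynomial factor
  is taken at the right end, the decreasing Gaussian at the left end.\<close>

definition "\<kappa> a c = K0 * (1 + c / eps) ^ 4 * gauss a"

lemma derivative_bounds:
  assumes "0 \<le> a" "a \<le> x" "x \<le> c" "c \<le> 1"
  shows "\<bar>u2 x\<bar> \<le> \<kappa> a c / eps ^ 2" "\<bar>u3 x\<bar> \<le> \<kappa> a c / eps ^ 3" "\<bar>u4 x\<bar> \<le> \<kappa> a c / eps ^ 4"
    "\<bar>G2 x\<bar> \<le> \<kappa> a c / eps" "\<bar>G3 x\<bar> \<le> \<kappa> a c / eps ^ 2"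
proof -
  have x: "x \<in> {0..1}" using assms by auto
  note ux = u_range[OF x]
  define t where "t = x / eps"
  have xt: "x = t * eps" using eps_pos by (simp add: t_def)
  define v1 where "v1 = eps * u1 x"
  define v2 where "v2 = eps ^ 2 * u2 x"
  define v3 where "v3 = eps ^ 3 * u3 x"
  define v4 where "v4 = eps ^ 4 * u4 x"
  have 1: "\<bar>b (u x)\<bar> \<le> B" using b_bounds[OF ux] bmin_pos bmax_le_B by auto
  have 2: "0 \<le> t" using x eps_pos by (simp add: t_def)
  have 3: "\<bar>v1\<bar> \<le> C0 * gauss x" using u1_bound[OF x] eps_pos by (simp add: v1_def abs_mult field_simps)
  have 4: "v2 = - (t * b (u x) * v1)"
    using eps_pos by (simp add: v2_def v1_def u2_eq[OF x] t_def field_simps power2_eq_square)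
  have 5: "v3 = - (b (u x) * v1 + t * b1 (u x) * v1\<^sup>2 + t * b (u x) * v2)"
    using eps_pos by (simp add: v3_def v2_def v1_def u3_def t_def field_simps power_numeral_reduce)
  have 6: "v4 = - (2 * b1 (u x) * v1\<^sup>2 + 2 * b (u x) * v2 + t * b2 (u x) * v1 ^ 3
      + 3 * t * b1 (u x) * v1 * v2 + t * b (u x) * v3)"
    using eps_pos by (simp add: v4_def v3_def v2_def v1_def u4_def t_def field_simps power_numeral_reduce)
  note bounds = scaled_derivative_bounds[OF 1 b1_bound[OF ux] b2_bound[OF ux] B_ge_1 C0_ge_1 2
      less_imp_le[OF gauss_pos] gauss_le_1 3 4 5 6]
  have "(1 + t) ^ 4 * gauss x \<le> (1 + c / eps) ^ 4 * gauss a"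
    using assms eps_pos 2 gauss_pos[of x]
    by (intro mult_mono power_mono gauss_antimono) (auto simp: t_def divide_right_mono)
  then have "11 * (B * C0) ^ 4 * (1 + t) ^ 4 * gauss x \<le> \<kappa> a c"
    using K0_ge_1 by (simp add: \<kappa>_def K0_def mult.assoc mult_left_mono)
  note bounds' = bounds[THEN order_trans[OF _ this]]
  show "\<bar>u2 x\<bar> \<le> \<kappa> a c / eps ^ 2" "\<bar>u3 x\<bar> \<le> \<kappa> a c / eps ^ 3" "\<bar>u4 x\<bar> \<le> \<kappa> a c / eps ^ 4"
    using bounds'(1-3) eps_pos
    by (simp_all add: v2_def v3_def v4_def abs_mult pos_le_divide_eq mult.commute)
  show "\<bar>G2 x\<bar> \<le> \<kappa> a c / eps"
    using bounds'(4) eps_pos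
    by (simp add: G2_def v1_def abs_mult pos_le_divide_eq mult_ac)
  have "b1 (u x) * v1\<^sup>2 + b (u x) * v2 = eps ^ 2 * G3 x"
    by (simp add: G3_def v1_def v2_def power_mult_distrib algebra_simps)
  then show "\<bar>G3 x\<bar> \<le> \<kappa> a c / eps ^ 2"
    using bounds'(5) eps_pos by (simp add: abs_mult pos_le_divide_eq mult_ac)
qed

lemma \<kappa>_nonneg: "0 \<le> c \<Longrightarrow> 0 \<le> \<kappa> a c"
  using K0_ge_1 gauss_pos[of a] eps_pos by (simp add: \<kappa>_def)

text \<open>Obtained by integrating \<open>\<bar>u1 s\<bar> \<le> C1 * eps / s\<^sup>2\<close> over \<open>[x, 1]\<close>.\<close>

lemma flux_decay:
  assumes x: "x \<in> {0..1}"
  shows "x * \<bar>F (u x)\<bar> \<le> B * C1 * eps"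
proof (cases "x = 0")
  case True
  then show ?thesis using B_ge_1 C1_ge_1 eps_pos by simp
next
  case False
  with x have x0: "0 < x" "x \<le> 1" by auto
  have "u1 s - C1 * eps / s\<^sup>2 \<le> 0" if s: "s \<in> {x..1}" for s
  proof -
    have s0: "0 < s" "s \<in> {0..1}" using s x0 by auto
    have "(s / eps) ^ 2 * gauss s \<le> (1 + s / eps) ^ 2 * gauss s"
      using s0 eps_pos gauss_pos[of s] by (intro mult_right_mono power_mono) auto
    also have "\<dots> \<le> exp ((real 2)\<^sup>2 / (4 * (bmin / 2)))"
      unfolding gauss_def using s0 eps_pos bmin_pos by (intro power_mult_gauss_le) auto
    finally have "gauss s \<le> exp (2 / bmin) * eps\<^sup>2 / s\<^sup>2"
      using s0 eps_pos by (simp add: field_simps)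
    then have "C0 / eps * gauss s \<le> C0 / eps * (exp (2 / bmin) * eps\<^sup>2 / s\<^sup>2)"
      using C0_ge_1 eps_pos by (intro mult_left_mono) auto
    also have "\<dots> = C1 * eps / s\<^sup>2" using eps_pos by (simp add: C1_def power2_eq_square)
    finally show ?thesis using u1_bound[OF s0(2)] by linarith
  qed
  \<comment> \<open>The integration is replaced by monotonicity: \<open>u s + C1 * eps / s\<close>
    has a nonpositive derivative on \<open>[x, 1]\<close>.\<close>
  moreover obtain z where "z \<in> {x..1}"
    "(u 1 + C1 * eps / 1) - (u x + C1 * eps / x) = (u1 z - C1 * eps / z\<^sup>2) * (1 - x)"
  proof (rule mvt_within[of "{x..1}" "\<lambda>s. u s + C1 * eps / s" "\<lambda>s. u1 s - C1 * eps / s\<^sup>2" x 1])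
    fix s assume s: "s \<in> {x..1}"
    have "(u has_real_derivative u1 s) (at s within {x..1})"
      by (rule has_field_derivative_subset[OF u_deriv]) (use s x0 in auto)
    then show "((\<lambda>s. u s + C1 * eps / s) has_real_derivative u1 s - C1 * eps / s\<^sup>2) (at s within {x..1})"
      using s x0 by (auto intro!: derivative_eq_intros simp: power2_eq_square)
  qed (use x0 in auto)
  ultimately have "u 1 + C1 * eps \<le> u x + C1 * eps / x"
    using x0 by (smt (verit) div_by_1 mult_nonpos_nonneg)
  then have gap: "x * (Up - u x) \<le> C1 * eps"
    using x0 u_1 C1_ge_1 eps_pos
    by (smt (verit) mult_nonneg_nonneg mult.commute pos_le_divide_eq)
  moreover obtain a where a: "bmin \<le> a" "a \<le> bmax" "F (u x) - F Up = a * (u x - Up)"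
    using flux_x_diff[of "u x" Up] u_range[OF x] Um_less_Up by auto
  have "x * \<bar>F (u x)\<bar> = a * (x * (Up - u x))"
    using a bmin_pos u_range[OF x] by (simp add: abs_mult)
  also have "\<dots> \<le> B * (C1 * eps)"
    by (rule mult_mono[OF _ gap]) (use a bmin_pos bmax_le_B B_ge_1 x0 u_range[OF x] in auto)
  finally show ?thesis by simp
qed

end

subsection \<open>Stability of the scheme\<close>

text \<open>Stability is proved from these mesh properties alone. Equality of the last two steps
  matters at the right boundary if the flux is central on the last interval: the switching criterion
  then speaks of interval \<open>N - 1\<close> only and has to be carried over to interval
  \<open>N\<close>.\<close>

locale layer_mesh = layer_problem +
  fixes eps :: real and N :: nat and x :: "nat \<Rightarrow> real"
  assumes eps_pos: "0 < eps" and N_ge_4: "4 \<le> N"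
    and x_0: "x 0 = 0" and x_N: "x N = 1"
    and step_pos: "\<And>i. i \<in> {1..N} \<Longrightarrow> 0 < step x i"
    and step_mono: "\<And>i. i \<in> {1..N-1} \<Longrightarrow> step x i \<le> step x (i + 1)"
    and last_steps: "step x N = step x (N - 1)"
begin

abbreviation "h \<equiv> step x"
abbreviation "ch \<equiv> chi bmax eps N x"
abbreviation "\<rho> \<equiv> rho bmax eps x"

section \<open>Switching between central and upwind fluxes\<close>

lemma x_Suc: "x (Suc i) = x i + h (Suc i)"
  by (simp add: step_def)

lemma x_mono: "i \<le> j \<Longrightarrow> j \<le> N \<Longrightarrow> x i \<le> x j"
proof (induction j)
  case (Suc j)
  then show ?case using step_pos[of "Suc j"] by (cases "i = Suc j") (auto simp: x_Suc)
qed simp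

lemma x_range: "i \<le> N \<Longrightarrow> x i \<in> {0..1}"
  using x_mono[of 0 i] x_mono[of i N] by (simp add: x_0 x_N)

lemma step_le_x: "i \<in> {1..N} \<Longrightarrow> h i \<le> x i"
  using x_range[of "i - 1"] by (force simp: step_def)

lemma rho_Suc_ge: "i \<in> {1..N-1} \<Longrightarrow> \<rho> i \<le> \<rho> (i + 1)"
proof -
  assume i: "i \<in> {1..N-1}"
  then have iN: "i \<le> N" "i - 1 \<le> N" by auto
  show "\<rho> i \<le> \<rho> (i + 1)"
    unfolding rho_def
    using i iN x_mono[of "i - 1" i] x_range[OF iN(1)] x_range[OF iN(2)] step_pos[of i] step_mono[OF i]
      bmax_pos
    by (intro divide_right_mono mult_mono mult_nonneg_nonneg) auto
qed

lemma rho_mono: "i \<le> j \<Longrightarrow> 1 \<le> i \<Longrightarrow> j \<le> N \<Longrightarrow> \<rho> i \<le> \<rho> j"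
proof (induction j)
  case (Suc j)
  show ?case
  proof (cases "i = Suc j")
    case False
    with Suc have "i \<le> j" "j \<in> {1..N-1}" by auto
    with Suc rho_Suc_ge[of j] show ?thesis by force
  qed simp
qed simp

definition "n = switch_index bmax eps N x"

lemma n_range: "n \<in> {1..N-1}" and rho_n: "\<rho> n \<le> 1"
  and rho_gt_n: "i \<in> {1..N-1} \<Longrightarrow> n < i \<Longrightarrow> 1 < \<rho> i"
proof -
  let ?S = "{i \<in> {1..N-1}. \<rho> i \<le> 1}"
  have "1 \<in> ?S" using N_ge_4 by (simp add: rho_def x_0)
  then have "Max ?S \<in> ?S" by (intro Max_in) auto
  then show "n \<in> {1..N-1}" "\<rho> n \<le> 1" by (auto simp: n_def switch_index_def)
  show "1 < \<rho> i" if "i \<in> {1..N-1}" "n < i"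
  proof (rule ccontr)
    assume "\<not> 1 < \<rho> i"
    then have "i \<le> Max ?S" using that by (intro Max_ge) auto
    then show False using that by (simp add: n_def switch_index_def)
  qed
qed

text \<open>\<open>cen i\<close> says that the numerical flux through the interval \<open>[x (i - 1), x i]\<close> is the central
  one. In terms of these fluxes the three schemes become a single conservative scheme.\<close>

definition "cen i \<longleftrightarrow> n \<noteq> 1 \<and> (n = N - 1 \<or> i \<le> n)"

lemma cen_Suc: "cen (Suc i) \<Longrightarrow> cen i"
  by (auto simp: cen_def)

lemma rho_if_cen: "cen i \<Longrightarrow> i \<in> {1..N-1} \<Longrightarrow> \<rho> i \<le> 1"
  using rho_mono[of i n] rho_n n_range N_ge_4 by (force simp: cen_def)

text \<open>For \<open>i = N - 1\<close> the claim concerns \<open>rho\<close> at \<open>N\<close>,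
  outside the range of the maximum defining \<open>n\<close>; monotonicity carries it over from
  \<open>N - 1\<close>.\<close>

lemma rho_if_not_cen: "\<not> cen (Suc i) \<Longrightarrow> i \<in> {1..N-1} \<Longrightarrow> 1 < \<rho> (Suc i)"
proof -
  assume *: "\<not> cen (Suc i)" "i \<in> {1..N-1}"
  have N: "N - 1 \<in> {1..N-1}" using N_ge_4 by auto
  have "n < Suc i" "n < N - 1" using * n_range N_ge_4 by (auto simp: cen_def)
  show "1 < \<rho> (Suc i)"
  proof (cases "i = N - 1")
    case True
    then show ?thesis
      using rho_gt_n[OF N \<open>n < N - 1\<close>] rho_mono[of "N - 1" "Suc i"] N N_ge_4 by auto
  next
    case False
    then show ?thesis using rho_gt_n[of "Suc i"] \<open>n < Suc i\<close> *(2) by auto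
  qed
qed

text \<open>A central interval gives half of its length to each end, an upwind interval all of it to
  its left end. This covers all cases of \<open>chi\<close>, the transition row included.\<close>

lemma chi_eq:
  "i \<in> {1..N-1} \<Longrightarrow>
     ch i = (if cen i then h i / 2 else 0) + (if cen (Suc i) then h (Suc i) / 2 else h (Suc i))"
  using n_range N_ge_4
  by (auto simp: chi_def Let_def avg_step_def cen_def field_simps simp flip: n_def)

lemma chi_bounds:
  assumes "i \<in> {1..N-1}"
  shows "0 < ch i" "h (Suc i) / 2 \<le> ch i" "ch i \<le> 3 / 2 * h (Suc i)"
proof -
  have "i \<in> {1..N}" "Suc i \<in> {1..N}" using assms by auto
  then show "0 < ch i" "h (Suc i) / 2 \<le> ch i" "ch i \<le> 3 / 2 * h (Suc i)"
    using step_pos[of i] step_pos[of "Suc i"] step_mono[OF assms] by (auto simp: chi_eq[OF assms])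
qed

text \<open>The discrete counterpart of \<open>eps^2 * u' + x * F u\<close>. Keeping
  \<open>g\<close> separate from \<open>w\<close> lets one formula serve both the nonlinear scheme
  and its linearisation, where \<open>g\<close> is a coefficient times \<open>w\<close>. Transport
  is towards \<open>x = 0\<close>, so the upwind value sits at the right end.\<close>

definition "edge_flux g w i = eps\<^sup>2 * (w i - w (i - 1)) / h i +
   (if cen i then (x i * g i + x (i - 1) * g (i - 1)) / 2 else x i * g i)" for g w :: "nat \<Rightarrow> real"

definition "reaction g i = (if cen i then ch i * g i else h (Suc i) * (g i + g (Suc i)) / 2)"
  for g :: "nat \<Rightarrow> real"

definition "scheme g w i = edge_flux g w i - edge_flux g w (Suc i) + reaction g i"
  for g w :: "nat \<Rightarrow> real"

lemma chi_T_op: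
  fixes w v g :: "nat \<Rightarrow> real"
  assumes i: "i \<in> {1..N-1}"
  defines "v \<equiv> extend_bc Um Up N w"
  defines "g \<equiv> \<lambda>j. F (v j)"
  shows "ch i * T_op b bmax Um Up eps N x w i =
     scheme g v i"
proof -
  have pos: "0 < ch i" "0 < h i" "0 < h (Suc i)"
    using chi_bounds[OF i] step_pos[of i] step_pos[of "Suc i"] i by auto
  have D2: "ch i * (eps\<^sup>2 * D2 ch x v i) =
      eps\<^sup>2 * (v (i - 1) - v i) / h i + eps\<^sup>2 * (v (Suc i) - v i) / h (Suc i)"
  proof -
    have "ch i * (eps\<^sup>2 * D2 ch x v i) =
        eps\<^sup>2 * ((v (i - 1) - v i) / h i + (v (Suc i) - v i) / h (Suc i))"
      using pos by (simp add: D2_def)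
    then show ?thesis by (simp add: distrib_left)
  qed
  consider (c) "cen i" "cen (Suc i)" | (p) "\<not> cen i" "\<not> cen (Suc i)" | (t) "cen i" "\<not> cen (Suc i)"
    using cen_Suc by blast
  then show ?thesis
  proof cases
    case c
    have T: "T_op b bmax Um Up eps N x w i = T_c b Up eps ch x v i"
      using c i n_range unfolding T_op_def Let_def v_def cen_def n_def[symmetric] by auto
    have a: "ch i = avg_step x i" using c by (simp add: chi_eq[OF i] avg_step_def)
    have "ch i * T_c b Up eps ch x v i = - (ch i * (eps\<^sup>2 * D2 ch x v i))
      - (x (Suc i) * g (Suc i) - x (i - 1) * g (i - 1)) / 2 + ch i * g i"
      using pos by (simp add: T_c_def flux_def g_def a[symmetric] field_simps)
    then show ?thesis unfolding T D2 using c
      by (simp add: scheme_def edge_flux_def reaction_def add_divide_distrib diff_divide_distrib algebra_simps)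
  next
    case p
    have T: "T_op b bmax Um Up eps N x w i = T_plus b Up eps ch x v i"
      using p i n_range unfolding T_op_def Let_def v_def cen_def n_def[symmetric] by auto
    have a: "ch i = h (Suc i)" using p by (simp add: chi_eq[OF i])
    have "ch i * T_plus b Up eps ch x v i = - (ch i * (eps\<^sup>2 * D2 ch x v i))
      - (x (Suc i) * g (Suc i) - x i * g i) + h (Suc i) * (g i + g (Suc i)) / 2"
      using pos by (simp add: T_plus_def flux_def g_def a field_simps)
    then show ?thesis unfolding T D2 using p
      by (simp add: scheme_def edge_flux_def reaction_def add_divide_distrib diff_divide_distrib algebra_simps)
  next
    case t
    have T: "T_op b bmax Um Up eps N x w i = T_t b Up eps ch x v i"
      using t i n_range unfolding T_op_def Let_def v_def cen_def n_def[symmetric] by auto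
    have "ch i * T_t b Up eps ch x v i = - (ch i * (eps\<^sup>2 * D2 ch x v i))
      - (2 * (x (Suc i) * g (Suc i)) - x i * g i - x (i - 1) * g (i - 1)) / 2 + ch i * g i"
      using pos by (simp add: T_t_def flux_def g_def field_simps)
    then show ?thesis unfolding T D2 using t
      by (simp add: scheme_def edge_flux_def reaction_def add_divide_distrib diff_divide_distrib algebra_simps)
  qed
qed

section \<open>Stability of the linearised and of the nonlinear scheme\<close>

lemma scheme_diff: "scheme (\<lambda>i. g i - g' i) (\<lambda>i. w i - w' i) i = scheme g w i - scheme g' w' i"
  by (simp add: scheme_def edge_flux_def reaction_def diff_divide_distrib add_divide_distrib algebra_simps)

text \<open>The linearised scheme is an M-matrix; the sign conditions on the off-diagonal entries are where
  \<open>\<rho> i \<le> 1\<close> enters.\<close>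

lemma scheme_abs_le:
  fixes a v :: "nat \<Rightarrow> real"
  assumes i: "i \<in> {1..N-1}" and a: "\<And>j. j \<le> N \<Longrightarrow> 0 \<le> a j \<and> a j \<le> bmax"
  shows "scheme (\<lambda>j. a j * \<bar>v j\<bar>) (\<lambda>j. \<bar>v j\<bar>) i \<le> \<bar>scheme (\<lambda>j. a j * v j) v i\<bar>"
proof -
  define \<delta> where "\<delta> = eps\<^sup>2 / h i + eps\<^sup>2 / h (Suc i) + (if cen i then x i * a i / 2 else x i * a i)
    - (if cen (Suc i) then x i * a i / 2 else 0) + (if cen i then ch i * a i else h (Suc i) * a i / 2)"
  define lo where "lo = eps\<^sup>2 / h i - (if cen i then x (i - 1) * a (i - 1) / 2 else 0)"
  define hi where "hi = eps\<^sup>2 / h (Suc i)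
    + (if cen (Suc i) then x (Suc i) * a (Suc i) / 2 else x (Suc i) * a (Suc i))
    - (if cen i then 0 else h (Suc i) * a (Suc i) / 2)"
  have iN: "i \<in> {1..N}" "Suc i \<in> {1..N}" "i - 1 \<le> N" "Suc i \<le> N" using i by auto
  note pos = step_pos[OF iN(1)] step_pos[OF iN(2)]
  have expand: "scheme (\<lambda>j. a j * w j) w i = \<delta> * w i - lo * w (i - 1) - hi * w (Suc i)" for w
    using pos
    by (simp add: scheme_def edge_flux_def reaction_def \<delta>_def lo_def hi_def diff_divide_distrib
        add_divide_distrib algebra_simps)
  have "0 \<le> lo"
  proof (cases "cen i")
    case True
    from rho_if_cen[OF this i] have "bmax * x (i - 1) * h i \<le> 2 * eps\<^sup>2"
      using eps_pos by (simp add: rho_def divide_le_eq)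
    moreover have "a (i - 1) * x (i - 1) * h i \<le> bmax * x (i - 1) * h i"
      using a[OF iN(3)] x_range[OF iN(3)] pos by (intro mult_right_mono) auto
    ultimately have "a (i - 1) * x (i - 1) * h i \<le> 2 * eps\<^sup>2" by linarith
    then show ?thesis using True pos by (simp add: lo_def field_simps)
  qed (use pos in \<open>simp add: lo_def\<close>)
  \<comment> \<open>The averaged reaction puts a negative term into this entry, which
    \<open>h (Suc i) <= x (Suc i)\<close> compensates. By \<open>cen_Suc\<close> it never meets a
    halved, central convection term.\<close>
  moreover have "0 \<le> hi"
  proof -
    have "h (Suc i) * a (Suc i) \<le> x (Suc i) * a (Suc i)" "0 \<le> h (Suc i) * a (Suc i)"
      using step_le_x[OF iN(2)] a[OF iN(4)] pos by (auto intro: mult_right_mono)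
    moreover define e where "e = eps\<^sup>2 / h (Suc i)"
    moreover have "0 < e" using pos eps_pos by (simp add: e_def)
    ultimately show ?thesis using cen_Suc[of i] by (simp add: hi_def flip: e_def)
  qed
  moreover have "sgn (v i) * w \<le> \<bar>w\<bar>" for w by (auto simp: sgn_if abs_if)
  ultimately have "lo * (sgn (v i) * v (i - 1)) \<le> lo * \<bar>v (i - 1)\<bar>"
    "hi * (sgn (v i) * v (Suc i)) \<le> hi * \<bar>v (Suc i)\<bar>"
    by (auto intro: mult_left_mono)
  moreover have "sgn (v i) * scheme (\<lambda>j. a j * v j) v i =
      \<delta> * \<bar>v i\<bar> - lo * (sgn (v i) * v (i - 1)) - hi * (sgn (v i) * v (Suc i))"
    by (simp add: expand abs_sgn algebra_simps)
  ultimately have "scheme (\<lambda>j. a j * \<bar>v j\<bar>) (\<lambda>j. \<bar>v j\<bar>) i \<le> sgn (v i) * scheme (\<lambda>j. a j * v j) v i"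
    by (simp add: expand)
  also have "\<dots> \<le> \<bar>scheme (\<lambda>j. a j * v j) v i\<bar>" by (auto simp: sgn_if abs_if)
  finally show ?thesis .
qed

text \<open>Summation leaves the reaction and two boundary fluxes. The flux at 1 is nonnegative as
  \<open>V 0\<close> and \<open>x 0\<close> vanish. At \<open>N\<close> an upwind flux is
  nonpositive; a central one contains \<open>x (N - 1) * D (N - 1) / 2\<close>, of which
  \<open>rho (N - 1) <= 1\<close> and the equal last steps leave at most half of the last reaction
  term. The averaged upwind reaction also guarantees only one half, hence the division by 2.\<close>

lemma sum_scheme_ge:
  fixes a V :: "nat \<Rightarrow> real"
  assumes a: "\<And>j. j \<le> N \<Longrightarrow> bmin \<le> a j \<and> a j \<le> bmax" and V: "\<And>j. 0 \<le> V j" "V 0 = 0" "V N = 0"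
  shows "(\<Sum>i=1..N-1. ch i * (a i * V i)) / 2 \<le> (\<Sum>i=1..N-1. scheme (\<lambda>j. a j * V j) V i)"
proof -
  define D where "D j = a j * V j" for j
  have D0: "0 \<le> D j" if "j \<le> N" for j using a[OF that] V(1)[of j] bmin_pos by (simp add: D_def)
  have idx: "{1..N-1} = {1..<N}" using N_ge_4 by auto
  have "(\<Sum>i=1..N-1. edge_flux D V i - edge_flux D V (Suc i)) = edge_flux D V 1 - edge_flux D V N"
    unfolding idx using N_ge_4 sum_Suc_diff'[of 1 N "\<lambda>i. - edge_flux D V i"] by simp
  then have tel: "(\<Sum>i=1..N-1. scheme D V i) = edge_flux D V 1 - edge_flux D V N + (\<Sum>i=1..N-1. reaction D i)"
    by (simp add: scheme_def sum.distrib)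
  have first: "0 \<le> edge_flux D V 1"
    using V(1)[of 1] D0[of 1] x_range[of 1] step_pos[of 1] N_ge_4
    by (simp add: edge_flux_def V x_0)
  have "(\<Sum>i=1..N-1. ch i * D i) / 2 \<le> (\<Sum>i=1..N-1. scheme D V i)"
  proof (cases "n = N - 1")
    case True
    then have cen: "cen i" for i using N_ge_4 by (auto simp: cen_def)
    define k where "k = N - 2"
    have k: "N = Suc (Suc k)" "Suc k \<in> {1..N-1}" using N_ge_4 by (auto simp: k_def)
    have hN: "h (Suc (Suc k)) = h (Suc k)" using last_steps k by simp
    have hp: "0 < h (Suc k)" using step_pos[of "Suc k"] k by simp
    have "bmax * x k * h (Suc k) \<le> 2 * eps\<^sup>2"
      using rho_if_cen[OF cen k(2)] eps_pos by (simp add: rho_def divide_le_eq)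
    moreover have "a (Suc k) * x k * h (Suc k) \<le> bmax * x k * h (Suc k)"
      using a[of "Suc k"] x_range[of k] hp k by (intro mult_right_mono) auto
    ultimately have "(a (Suc k) * x k * h (Suc k)) * V (Suc k) \<le> (2 * eps\<^sup>2) * V (Suc k)"
      using V(1)[of "Suc k"] by (intro mult_right_mono) auto
    then have "x k * D (Suc k) / 2 \<le> eps\<^sup>2 * V (Suc k) / h (Suc k)"
      using hp by (simp add: D_def field_simps)
    moreover have "D N = 0" by (simp add: D_def V)
    moreover have "ch (Suc k) = h (Suc k)" using cen hN by (simp add: chi_eq[OF k(2)])
    moreover have "N - 1 = Suc k" "h N = h (Suc k)" using k(1) hN by auto
    ultimately have last: "edge_flux D V N \<le> ch (Suc k) * D (Suc k) / 2"
      using V cen by (simp add: edge_flux_def x_Suc algebra_simps add_divide_distrib)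
    have "ch (Suc k) * D (Suc k) \<le> (\<Sum>i=1..N-1. ch i * D i)"
    proof (rule member_le_sum)
      show "0 \<le> ch i * D i" if "i \<in> {1..N-1} - {Suc k}" for i
        using that chi_bounds(1)[of i] D0[of i] by force
    qed (use k in auto)
    moreover have "(\<Sum>i=1..N-1. reaction D i) = (\<Sum>i=1..N-1. ch i * D i)"
      by (simp add: reaction_def cen)
    ultimately show ?thesis using tel first last by linarith
  next
    case False
    then have ncen: "\<not> cen N" using n_range N_ge_4 by (auto simp: cen_def)
    have "edge_flux D V N \<le> 0"
      using ncen V(1)[of "N - 1"] step_pos[of N] N_ge_4
      by (auto simp: edge_flux_def V D_def intro!: divide_nonpos_pos)
    moreover have "(\<Sum>i=1..N-1. ch i * D i / 2) \<le> (\<Sum>i=1..N-1. reaction D i)"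
    proof (rule sum_mono)
      fix i assume i: "i \<in> {1..N-1}"
      then have iN: "i \<le> N" "Suc i \<le> N" "Suc i \<in> {1..N}" by auto
      note nonneg = D0[OF iN(1)] D0[OF iN(2)] chi_bounds(1)[OF i] step_pos[OF iN(3)]
      show "ch i * D i / 2 \<le> reaction D i"
      proof (cases "cen i")
        case True
        then show ?thesis using nonneg by (simp add: reaction_def)
      next
        case F: False
        then have "ch i = h (Suc i)" using cen_Suc[of i] by (auto simp: chi_eq[OF i])
        then show ?thesis using nonneg F by (simp add: reaction_def distrib_left add_divide_distrib)
      qed
    qed
    ultimately show ?thesis using tel first by (simp add: sum_divide_distrib)
  qed
  then show ?thesis by (simp add: D_def[abs_def])
qed

text \<open>Secant slopes of \<open>F\<close>, which lie between \<open>bmin\<close> and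
  \<open>bmax\<close>, turn the difference of two nonlinear schemes into a linear one with
  coefficients \<open>a\<close>; no smallness of the difference is involved.\<close>

lemma stability:
  fixes W Z :: "nat \<Rightarrow> real"
  assumes W: "\<And>j. j \<le> N \<Longrightarrow> W j \<in> {Um..Up}" and Z: "\<And>j. j \<le> N \<Longrightarrow> Z j \<in> {Um..Up}"
    and bc: "W 0 = Z 0" "W N = Z N"
  shows "bmin / 2 * (\<Sum>i=1..N-1. ch i * \<bar>W i - Z i\<bar>) \<le>
    (\<Sum>i=1..N-1. \<bar>scheme (\<lambda>j. F (W j)) W i - scheme (\<lambda>j. F (Z j)) Z i\<bar>)"
proof -
  define v where "v j = W j - Z j" for j
  have "\<exists>c. j \<le> N \<longrightarrow> bmin \<le> c \<and> c \<le> bmax \<and> F (W j) - F (Z j) = c * v j" for j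
    using flux_x_diff[OF W Z, of j j] unfolding v_def by metis
  then obtain a where a: "\<And>j. j \<le> N \<Longrightarrow> bmin \<le> a j \<and> a j \<le> bmax"
    and d: "\<And>j. j \<le> N \<Longrightarrow> F (W j) - F (Z j) = a j * v j"
    by metis
  have "bmin / 2 * (\<Sum>i=1..N-1. ch i * \<bar>v i\<bar>) = (\<Sum>i=1..N-1. ch i * (bmin * \<bar>v i\<bar>)) / 2"
    by (simp add: sum_distrib_left mult_ac sum_divide_distrib)
  also have "\<dots> \<le> (\<Sum>i=1..N-1. ch i * (a i * \<bar>v i\<bar>)) / 2"
  proof (intro divide_right_mono sum_mono mult_left_mono mult_right_mono)
    fix i assume "i \<in> {1..N-1}"
    then show "bmin \<le> a i" "0 \<le> ch i" using a[of i] chi_bounds(1)[of i] by auto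
  qed auto
  also have "\<dots> \<le> (\<Sum>i=1..N-1. scheme (\<lambda>j. a j * \<bar>v j\<bar>) (\<lambda>j. \<bar>v j\<bar>) i)"
    by (rule sum_scheme_ge) (use a bc in \<open>auto simp: v_def\<close>)
  also have "\<dots> \<le> (\<Sum>i=1..N-1. \<bar>scheme (\<lambda>j. a j * v j) v i\<bar>)"
    by (intro sum_mono scheme_abs_le) (use a bmin_pos in \<open>force+\<close>)
  also have "\<dots> = (\<Sum>i=1..N-1. \<bar>scheme (\<lambda>j. F (W j)) W i - scheme (\<lambda>j. F (Z j)) Z i\<bar>)"
  proof (rule sum.cong)
    fix i assume i: "i \<in> {1..N-1}"
    have "scheme (\<lambda>j. a j * v j) v i = scheme (\<lambda>j. F (W j) - F (Z j)) (\<lambda>j. W j - Z j) i"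
      using i by (auto simp: scheme_def edge_flux_def reaction_def d v_def)
    then show "\<bar>scheme (\<lambda>j. a j * v j) v i\<bar> = \<bar>scheme (\<lambda>j. F (W j)) W i - scheme (\<lambda>j. F (Z j)) Z i\<bar>"
      by (simp only: scheme_diff)
  qed simp
  finally show ?thesis by (simp add: v_def)
qed

end

subsection \<open>Truncation error\<close>

locale layer_scheme = layer_mesh b b1 b2 Um Up bmin bmax B eps N x +
  layer_solution b b1 b2 Um Up bmin bmax B eps u u1 u2
  for b b1 b2 Um Up bmin bmax B eps N x u u1 u2
begin

section \<open>Errors of the numerical fluxes on the exact solution\<close>

definition "Z i = u (x i)"

definition "res i = scheme (\<lambda>j. F (Z j)) Z i"

lemma derivs_within:
  assumes "0 \<le> a" "c \<le> 1" "s \<in> {a..c}"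
  shows "(u has_real_derivative u1 s) (at s within {a..c})"
    "(u1 has_real_derivative u2 s) (at s within {a..c})"
    "(u2 has_real_derivative u3 s) (at s within {a..c})"
    "(u3 has_real_derivative u4 s) (at s within {a..c})"
    "(G has_real_derivative F (u s)) (at s within {a..c})"
    "((\<lambda>s. F (u s)) has_real_derivative G2 s) (at s within {a..c})"
    "(G2 has_real_derivative G3 s) (at s within {a..c})"
proof -
  have s: "s \<in> {0..1}" and sub: "{a..c} \<subseteq> {0..1}" using assms by auto
  note has_field_derivative_subset[OF _ sub]
  note * = this[OF u_deriv[OF s]] this[OF u1_deriv[OF s]] this[OF u2_deriv[OF s]]
    this[OF u3_deriv[OF s]] this[OF G_deriv[OF s]] this[OF G1_deriv[OF s]] this[OF G2_deriv[OF s]]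
  show "(u has_real_derivative u1 s) (at s within {a..c})"
    "(u1 has_real_derivative u2 s) (at s within {a..c})"
    "(u2 has_real_derivative u3 s) (at s within {a..c})"
    "(u3 has_real_derivative u4 s) (at s within {a..c})"
    "(G has_real_derivative F (u s)) (at s within {a..c})"
    "((\<lambda>s. F (u s)) has_real_derivative G2 s) (at s within {a..c})"
    "(G2 has_real_derivative G3 s) (at s within {a..c})"
    by (fact *)+
qed

text \<open>An enclosing interval \<open>[a, d]\<close> is allowed so that the two edges at a node
  share one constant, that of the whole stencil.\<close>

context
  fixes a d :: real and j :: nat
  assumes j: "j \<in> {1..N}" and a: "0 \<le> a" "a \<le> x (j - 1)" and d: "x j \<le> d" "d \<le> 1"
begin

private lemma hj: "x j = x (j - 1) + h j" "0 \<le> h j" "0 \<le> x (j - 1)" "x j \<le> 1"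
  using step_pos[OF j] a d by (auto simp: step_def)

private lemma bounds_ad:
  assumes "s \<in> {x (j - 1)..x j}"
  shows "\<bar>u2 s\<bar> \<le> \<kappa> a d / eps ^ 2" "\<bar>u3 s\<bar> \<le> \<kappa> a d / eps ^ 3"
    "\<bar>G2 s\<bar> \<le> \<kappa> a d / eps" "\<bar>G3 s\<bar> \<le> \<kappa> a d / eps ^ 2"
proof -
  have "0 \<le> a" "a \<le> s" "s \<le> d" "d \<le> 1" using assms a d by auto
  note derivative_bounds[OF this]
  then show "\<bar>u2 s\<bar> \<le> \<kappa> a d / eps ^ 2" "\<bar>u3 s\<bar> \<le> \<kappa> a d / eps ^ 3"
    "\<bar>G2 s\<bar> \<le> \<kappa> a d / eps" "\<bar>G3 s\<bar> \<le> \<kappa> a d / eps ^ 2" by blast+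
qed

lemma central_edge_error:
  "\<bar>(Z j - Z (j - 1)) / h j - (u1 (x j) + u1 (x (j - 1))) / 2\<bar> \<le> \<kappa> a d / eps ^ 3 * (h j)\<^sup>2"
proof -
  have "\<bar>u (x j) - u (x (j - 1)) - h j * (u1 (x (j - 1)) + u1 (x j)) / 2\<bar> \<le> \<kappa> a d / eps ^ 3 * h j ^ 3"
    by (rule trapezoid_bound[OF derivs_within(1-2)[OF hj(3,4)] hj(2) derivs_within(3)[OF hj(3,4)]
        hj(1) bounds_ad(2)])
  then have "\<bar>(u (x j) - u (x (j - 1)) - h j * (u1 (x (j - 1)) + u1 (x j)) / 2) / h j\<bar>
      \<le> \<kappa> a d / eps ^ 3 * h j ^ 3 / h j"
    unfolding abs_divide using step_pos[OF j] by (intro frac_le) auto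
  then show ?thesis using step_pos[OF j]
    by (simp add: Z_def diff_divide_distrib power2_eq_square power3_eq_cube add.commute)
qed

lemma upwind_edge_error:
  "\<bar>(Z j - Z (j - 1)) / h j - u1 (x j)\<bar> \<le> \<kappa> a d / eps ^ 2 * h j"
proof -
  have "\<bar>u (x j) - u (x (j - 1)) - h j * u1 (x j)\<bar> \<le> \<kappa> a d / eps ^ 2 * h j ^ 2"
    by (rule taylor1_right[OF derivs_within(1-2)[OF hj(3,4)] hj(2,1) bounds_ad(1)])
  then have "\<bar>(u (x j) - u (x (j - 1)) - h j * u1 (x j)) / h j\<bar> \<le> \<kappa> a d / eps ^ 2 * h j ^ 2 / h j"
    unfolding abs_divide using step_pos[OF j] by (intro frac_le) auto
  then show ?thesis using step_pos[OF j] by (simp add: Z_def diff_divide_distrib power2_eq_square)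
qed

lemma flux_taylor_left:
  "\<bar>G (x j) - G (x (j - 1)) - h j * F (Z (j - 1))\<bar> \<le> \<kappa> a d / eps * (h j)\<^sup>2"
  unfolding Z_def
  by (rule taylor1_left[OF derivs_within(5-6)[OF hj(3,4)] hj(2,1) bounds_ad(3)])

lemma flux_taylor_right:
  "\<bar>G (x j) - G (x (j - 1)) - h j * F (Z j)\<bar> \<le> \<kappa> a d / eps * (h j)\<^sup>2"
  unfolding Z_def
  by (rule taylor1_right[OF derivs_within(5-6)[OF hj(3,4)] hj(2,1) bounds_ad(3)])

lemma flux_trapezoid:
  "\<bar>G (x j) - G (x (j - 1)) - h j * (F (Z (j - 1)) + F (Z j)) / 2\<bar> \<le> \<kappa> a d / eps ^ 2 * h j ^ 3"
  unfolding Z_def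
  by (rule trapezoid_bound[OF derivs_within(5-6)[OF hj(3,4)] hj(2) derivs_within(7)[OF hj(3,4)]
      hj(1) bounds_ad(4)])

end

definition "\<tau> i = (Z i - Z (i - 1)) / h i - (u1 (x i) + u1 (x (i - 1))) / 2"
definition "\<nu> i = (Z i - Z (i - 1)) / h i - u1 (x i)"

text \<open>On the solution the convective part and \<open>eps^2 * u1\<close> combine to the exact
  flux \<open>G\<close>, so the difference quotient is the only source of error in the edge flux.
  What remains in \<open>res_cases\<close> are quadrature errors for
  \<open>G' = F u\<close>.\<close>

lemma edge_flux_exact:
  "edge_flux (\<lambda>j. F (Z j)) Z i =
    (if cen i then eps\<^sup>2 * \<tau> i + (G (x i) + G (x (i - 1))) / 2 else eps\<^sup>2 * \<nu> i + G (x i))"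
  by (simp add: edge_flux_def \<tau>_def \<nu>_def G_def Z_def algebra_simps add_divide_distrib diff_divide_distrib)

lemma res_cases:
  assumes i: "i \<in> {1..N-1}"
  shows "cen (Suc i) \<Longrightarrow> res i = eps\<^sup>2 * (\<tau> i - \<tau> (Suc i))
      - (G (x (Suc i)) - G (x (i - 1)) - (h i + h (Suc i)) * F (Z i)) / 2"
    "\<not> cen i \<Longrightarrow> res i = eps\<^sup>2 * (\<nu> i - \<nu> (Suc i))
      - (G (x (Suc i)) - G (x i) - h (Suc i) * (F (Z i) + F (Z (Suc i))) / 2)"
    "cen i \<Longrightarrow> \<not> cen (Suc i) \<Longrightarrow> res i = eps\<^sup>2 * (\<tau> i - \<nu> (Suc i))
      - (G (x (Suc i)) - G (x i) - h (Suc i) * F (Z i)) - (G (x i) - G (x (i - 1)) - h i * F (Z i)) / 2"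
  using cen_Suc[of i]
  by (auto simp: res_def scheme_def edge_flux_exact reaction_def chi_eq[OF i] algebra_simps
      add_divide_distrib diff_divide_distrib)

text \<open>For unequal steps the two edge errors are estimated separately. For equal steps their
  difference is a second-difference remainder, which gains one power of \<open>H\<close>. The
  transition row mixes a central with an upwind error, so nothing cancels there.\<close>

lemma truncation_raw:
  assumes i: "i \<in> {1..N-1}"
  defines "k \<equiv> \<kappa> (x (i - 1)) (x (Suc i))" and "H \<equiv> h (Suc i)"
  shows "cen (Suc i) \<Longrightarrow> \<bar>res i\<bar> \<le> 3 * (k / eps * H\<^sup>2)"
    "\<not> cen i \<Longrightarrow> \<bar>res i\<bar> \<le> 2 * (k * H) + k / eps ^ 2 * H ^ 3"
    "cen i \<Longrightarrow> \<not> cen (Suc i) \<Longrightarrow> \<bar>res i\<bar> \<le> k * H + 3 * (k / eps * H\<^sup>2)"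
    "cen (Suc i) \<Longrightarrow> h i = H \<Longrightarrow> \<bar>res i\<bar> \<le> 2 * (k / eps ^ 2 * H ^ 3)"
    "\<not> cen i \<Longrightarrow> h i = H \<Longrightarrow> \<bar>res i\<bar> \<le> 3 * (k / eps * H\<^sup>2) + k / eps ^ 2 * H ^ 3"
proof -
  have iN: "i \<in> {1..N}" "Suc i \<in> {1..N}" "i - 1 \<le> N" "Suc i \<le> N" using i by auto
  have pos: "0 < h i" "0 < H" "h i \<le> H"
    using step_pos[OF iN(1)] step_pos[OF iN(2)] step_mono[OF i] by (simp_all add: H_def)
  have xs: "0 \<le> x (i - 1)" "x (i - 1) \<le> x i" "x i \<le> x (Suc i)" "x (Suc i) \<le> 1"
    using x_range[OF iN(3)] x_range[OF iN(4)] x_mono[of "i - 1" i] x_mono[of i "Suc i"] iN by auto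
  have k0: "0 \<le> k" unfolding k_def using xs by (intro \<kappa>_nonneg) linarith
  have sq: "(h i)\<^sup>2 \<le> H\<^sup>2" using pos by (intro power_mono) auto
  have t1: "\<bar>\<tau> i\<bar> \<le> k / eps ^ 3 * H\<^sup>2"
  proof -
    have "\<bar>\<tau> i\<bar> \<le> k / eps ^ 3 * (h i)\<^sup>2"
      unfolding \<tau>_def k_def by (rule central_edge_error) (use iN xs in auto)
    also have "\<dots> \<le> k / eps ^ 3 * H\<^sup>2" using sq k0 eps_pos by (intro mult_left_mono) auto
    finally show ?thesis .
  qed
  have t2: "\<bar>\<tau> (Suc i)\<bar> \<le> k / eps ^ 3 * H\<^sup>2"
    unfolding \<tau>_def k_def H_def by (rule central_edge_error) (use iN xs in auto)
  have n1: "\<bar>\<nu> i\<bar> \<le> k / eps ^ 2 * H"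
  proof -
    have "\<bar>\<nu> i\<bar> \<le> k / eps ^ 2 * h i"
      unfolding \<nu>_def k_def by (rule upwind_edge_error) (use iN xs in auto)
    also have "\<dots> \<le> k / eps ^ 2 * H" using pos k0 eps_pos by (intro mult_left_mono) auto
    finally show ?thesis .
  qed
  have n2: "\<bar>\<nu> (Suc i)\<bar> \<le> k / eps ^ 2 * H"
    unfolding \<nu>_def k_def H_def by (rule upwind_edge_error) (use iN xs in auto)
  have g1: "\<bar>G (x i) - G (x (i - 1)) - h i * F (Z i)\<bar> \<le> k / eps * H\<^sup>2"
  proof -
    have "\<bar>G (x i) - G (x (i - 1)) - h i * F (Z i)\<bar> \<le> k / eps * (h i)\<^sup>2"
      unfolding k_def by (rule flux_taylor_right) (use iN xs in auto)
    also have "\<dots> \<le> k / eps * H\<^sup>2" using sq k0 eps_pos by (intro mult_left_mono) auto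
    finally show ?thesis .
  qed
  have g2: "\<bar>G (x (Suc i)) - G (x i) - H * F (Z i)\<bar> \<le> k / eps * H\<^sup>2"
    unfolding k_def H_def using flux_taylor_left[of "Suc i" "x (i - 1)" "x (Suc i)"] iN xs by simp
  have g3: "\<bar>G (x (Suc i)) - G (x i) - H * (F (Z i) + F (Z (Suc i))) / 2\<bar> \<le> k / eps ^ 2 * H ^ 3"
    unfolding k_def H_def using flux_trapezoid[of "Suc i" "x (i - 1)" "x (Suc i)"] iN xs by simp
  have e1: "\<bar>eps\<^sup>2 * (p - q)\<bar> \<le> eps\<^sup>2 * (P + Q)" if "\<bar>p\<bar> \<le> P" "\<bar>q\<bar> \<le> Q" for p q P Q
    using that by (simp add: abs_mult mult_left_mono abs_le_iff)
  have c1: "eps\<^sup>2 * (k / eps ^ 3 * H\<^sup>2 + k / eps ^ 3 * H\<^sup>2) = 2 * (k / eps * H\<^sup>2)"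
    using eps_pos by (simp add: field_simps power_numeral_reduce)
  have c2: "eps\<^sup>2 * (k / eps ^ 2 * H + k / eps ^ 2 * H) = 2 * (k * H)"
    using eps_pos by (simp add: field_simps)
  have c3: "eps\<^sup>2 * (k / eps ^ 3 * H\<^sup>2 + k / eps ^ 2 * H) = k / eps * H\<^sup>2 + k * H"
    using eps_pos by (simp add: field_simps power_numeral_reduce)
  have kH: "0 \<le> k / eps * H\<^sup>2" using k0 eps_pos by simp
  show "\<bar>res i\<bar> \<le> 3 * (k / eps * H\<^sup>2)" if "cen (Suc i)"
  proof -
    have "G (x (Suc i)) - G (x (i - 1)) - (h i + h (Suc i)) * F (Z i) =
        (G (x (Suc i)) - G (x i) - H * F (Z i)) + (G (x i) - G (x (i - 1)) - h i * F (Z i))"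
      by (simp add: H_def algebra_simps)
    then have "res i = eps\<^sup>2 * (\<tau> i - \<tau> (Suc i)) - ((G (x (Suc i)) - G (x i) - H * F (Z i))
        + (G (x i) - G (x (i - 1)) - h i * F (Z i))) / 2"
      using res_cases(1)[OF i that] by simp
    moreover have "\<bar>r\<bar> \<le> 3 * A" if "r = p - (y + z) / 2" "\<bar>p\<bar> \<le> 2 * A" "\<bar>y\<bar> \<le> A" "\<bar>z\<bar> \<le> A"
      for r p y z A :: real using that(2-4) unfolding that(1) abs_le_iff by (simp add: field_simps)
    ultimately show ?thesis using e1[OF t1 t2] g1 g2 unfolding c1 by blast
  qed
  show "\<bar>res i\<bar> \<le> 2 * (k * H) + k / eps ^ 2 * H ^ 3" if "\<not> cen i"
    using res_cases(2)[OF i that] e1[OF n1 n2] g3 unfolding c2 H_def[symmetric] by linarith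
  show "\<bar>res i\<bar> \<le> k * H + 3 * (k / eps * H\<^sup>2)" if "cen i" "\<not> cen (Suc i)"
  proof -
    have "\<bar>r\<bar> \<le> E + 3 * A"
      if "r = p - y - z / 2" "\<bar>p\<bar> \<le> A + E" "\<bar>y\<bar> \<le> A" "\<bar>z\<bar> \<le> A" "0 \<le> A"
      for r p y z A E :: real using that(2-5) unfolding that(1) abs_le_iff by (simp add: field_simps)
    then show ?thesis
      using res_cases(3)[OF i that] e1[OF t1 n2] g1 g2 kH unfolding c3 H_def[symmetric] by blast
  qed
  assume u: "h i = H"
  have sym: "x (i - 1) = x i - H" "x (Suc i) = x i + H" using u by (simp_all add: step_def H_def)
  have H0: "0 \<le> H" using pos by simp
  have dv: "\<bar>p\<bar> \<le> P / H" if "p = - (q / H)" "\<bar>q\<bar> \<le> P" for p q P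
    using that H0 by (simp add: abs_divide divide_right_mono)
  note dw = derivs_within[OF xs(1,4)]
  have db: "\<bar>u3 s\<bar> \<le> k / eps ^ 3" "\<bar>u4 s\<bar> \<le> k / eps ^ 4" "\<bar>G3 s\<bar> \<le> k / eps ^ 2"
    if "s \<in> {x (i - 1)..x (Suc i)}" for s
    unfolding k_def using that xs by (auto intro!: derivative_bounds)
  have "\<bar>(u (x (Suc i)) - 2 * u (x i) + u (x (i - 1))) - H * (u1 (x (Suc i)) - u1 (x (i - 1))) / 2\<bar>
      \<le> k / eps ^ 4 * H ^ 4"
    by (rule central_second_bound[OF dw(1-2) H0 dw(3) sym dw(4) db(2)])
  moreover have "\<tau> i - \<tau> (Suc i) = - (((u (x (Suc i)) - 2 * u (x i) + u (x (i - 1)))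
      - H * (u1 (x (Suc i)) - u1 (x (i - 1))) / 2) / H)"
    using u pos by (simp add: \<tau>_def Z_def H_def[symmetric] field_simps)
  ultimately have tt: "\<bar>\<tau> i - \<tau> (Suc i)\<bar> \<le> k / eps ^ 4 * H ^ 4 / H"
    by (rule dv[rotated])
  have "\<bar>(u (x (Suc i)) - 2 * u (x i) + u (x (i - 1))) - H * (u1 (x (Suc i)) - u1 (x i))\<bar>
      \<le> 3 * (k / eps ^ 3) * H ^ 3"
    by (rule forward_second_bound[OF dw(1-2) H0 dw(3) sym db(1)])
  moreover have "\<nu> i - \<nu> (Suc i) = - (((u (x (Suc i)) - 2 * u (x i) + u (x (i - 1)))
      - H * (u1 (x (Suc i)) - u1 (x i))) / H)"
    using u pos by (simp add: \<nu>_def Z_def H_def[symmetric] field_simps)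
  ultimately have nn: "\<bar>\<nu> i - \<nu> (Suc i)\<bar> \<le> 3 * (k / eps ^ 3) * H ^ 3 / H"
    by (rule dv[rotated])
  have gg: "\<bar>G (x (Suc i)) - G (x (i - 1)) - 2 * H * F (u (x i))\<bar> \<le> 2 * (k / eps ^ 2) * H ^ 3"
    by (rule central_first_bound[OF dw(5-6) H0 dw(7) sym db(3)])
  have e2: "\<bar>eps\<^sup>2 * p\<bar> \<le> eps\<^sup>2 * P" if "\<bar>p\<bar> \<le> P" for p P
    using that by (simp add: abs_mult mult_left_mono)
  show "\<bar>res i\<bar> \<le> 2 * (k / eps ^ 2 * H ^ 3)" if "cen (Suc i)"
  proof -
    have "eps\<^sup>2 * (k / eps ^ 4 * H ^ 4 / H) = k / eps ^ 2 * H ^ 3"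
      using eps_pos pos by (simp add: field_simps power_numeral_reduce)
    with e2[OF tt] have "\<bar>eps\<^sup>2 * (\<tau> i - \<tau> (Suc i))\<bar> \<le> k / eps ^ 2 * H ^ 3" by simp
    moreover have "res i = eps\<^sup>2 * (\<tau> i - \<tau> (Suc i))
        - (G (x (Suc i)) - G (x (i - 1)) - 2 * H * F (u (x i))) / 2"
      using res_cases(1)[OF i that] u by (simp add: Z_def flip: H_def)
    moreover have "\<bar>r\<bar> \<le> 2 * A" if "r = p - y / 2" "\<bar>p\<bar> \<le> A" "\<bar>y\<bar> \<le> 2 * A"
      for r p y A :: real using that(2-3) unfolding that(1) abs_le_iff by (simp add: field_simps)
    ultimately show ?thesis using gg[unfolded mult.assoc[of 2 "k / eps ^ 2"]] by blast
  qed
  show "\<bar>res i\<bar> \<le> 3 * (k / eps * H\<^sup>2) + k / eps ^ 2 * H ^ 3" if "\<not> cen i"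
  proof -
    have "eps\<^sup>2 * (3 * (k / eps ^ 3) * H ^ 3 / H) = 3 * (k / eps * H\<^sup>2)"
      using eps_pos pos by (simp add: field_simps power_numeral_reduce)
    with e2[OF nn] have "\<bar>eps\<^sup>2 * (\<nu> i - \<nu> (Suc i))\<bar> \<le> 3 * (k / eps * H\<^sup>2)" by simp
    then show ?thesis using res_cases(2)[OF i that] g3
      unfolding H_def[symmetric] by linarith
  qed
qed

text \<open>With \<open>s = h (Suc i) / eps\<close> and
  \<open>R = B * (1 + x (Suc i) / eps)\<close>, every row is brought to the common form. If interval
  \<open>Suc i\<close> is upwind, \<open>rho (Suc i) > 1\<close> gives \<open>R * s >= 1\<close>, so
  each missing power of \<open>s\<close> costs one factor \<open>R\<close>, two at most. A surplus
  power is removed by \<open>s <= R\<close>, as a step never exceeds its right end. The exponent 6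
  is the 4 of the derivative bounds plus these 2.\<close>

lemma truncation_error:
  assumes i: "i \<in> {1..N-1}"
  defines "P \<equiv> 4 * K0 * B\<^sup>2 * (1 + x (Suc i) / eps) ^ 6 * gauss (x (i - 1))"
  shows "\<bar>res i\<bar> \<le> eps * P * (h (Suc i) / eps)\<^sup>2"
    "h i = h (Suc i) \<Longrightarrow> \<bar>res i\<bar> \<le> eps * P * (h (Suc i) / eps) ^ 3"
proof -
  define k where "k = \<kappa> (x (i - 1)) (x (Suc i))"
  define s where "s = h (Suc i) / eps"
  define R where "R = B * (1 + x (Suc i) / eps)"
  have iN: "i \<in> {1..N}" "Suc i \<in> {1..N}" "i \<le> N" "Suc i \<le> N" using i by auto
  have hs: "h (Suc i) = eps * s" using eps_pos by (simp add: s_def)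
  have s0: "0 < s" using step_pos[OF iN(2)] eps_pos by (simp add: s_def)
  have xs: "0 \<le> x i" "x i \<le> x (Suc i)" using x_range[OF iN(3)] x_mono[of i "Suc i"] iN by auto
  have k0: "0 \<le> k" unfolding k_def using xs by (intro \<kappa>_nonneg) linarith
  have P: "P = 4 * k * R\<^sup>2" by (simp add: P_def k_def \<kappa>_def R_def power_numeral_reduce)
  have q0: "0 \<le> x (Suc i) / eps" using xs eps_pos by simp
  have R1: "1 * 1 \<le> R" unfolding R_def using B_ge_1 q0 by (intro mult_mono) auto
  have "s \<le> x (Suc i) / eps" using step_le_x[OF iN(2)] eps_pos by (simp add: s_def divide_right_mono)
  also have "\<dots> \<le> 1 * (1 + x (Suc i) / eps)" by simp
  also have "\<dots> \<le> R" unfolding R_def using B_ge_1 q0 by (intro mult_right_mono) auto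
  finally have sR: "s \<le> R" .
  have Rs: "1 \<le> R * s" if "\<not> cen (Suc i)"
  proof -
    have "1 < bmax * (x i / eps) * s / 2"
      using rho_if_not_cen[OF that i] eps_pos by (simp add: rho_def s_def power2_eq_square)
    also have "\<dots> \<le> B * (1 + x (Suc i) / eps) * s"
    proof -
      have "bmax * (x i / eps) \<le> B * (1 + x (Suc i) / eps)"
        using bmax_le_B bmax_pos B_ge_1 xs eps_pos
        by (intro mult_mono) (auto intro: order_trans[OF divide_right_mono[OF xs(2)]])
      moreover have "0 \<le> bmax * (x i / eps)" using bmax_pos xs eps_pos by simp
      moreover have "y / 2 \<le> Y" if "y \<le> Y" "0 \<le> y" for y Y :: real using that by linarith
      ultimately have "bmax * (x i / eps) / 2 \<le> B * (1 + x (Suc i) / eps)" by blast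
      then show ?thesis using mult_right_mono[of _ _ s] s0 by fastforce
    qed
    finally show ?thesis by (simp add: R_def)
  qed
  have R2: "R \<le> R\<^sup>2" "1 \<le> R\<^sup>2"
    using R1 mult_mono[of 1 R 1 R] by (simp_all add: power2_eq_square mult_le_cancel_left1)
  have s2: "s\<^sup>2 \<le> R\<^sup>2 * s\<^sup>2" "s ^ 3 \<le> R\<^sup>2 * s ^ 3" using R2 s0 by (simp_all add: mult_le_cancel_right1)
  have s32: "s ^ 3 \<le> R\<^sup>2 * s\<^sup>2"
  proof -
    have "s * s\<^sup>2 \<le> R\<^sup>2 * s\<^sup>2" using sR R2 by (intro mult_right_mono) auto
    then show ?thesis by (simp add: power_numeral_reduce)
  qed
  have up: "s \<le> R\<^sup>2 * s\<^sup>2" "s \<le> R\<^sup>2 * s ^ 3" "s\<^sup>2 \<le> R\<^sup>2 * s ^ 3" if "\<not> cen (Suc i)"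
  proof -
    note Rs[OF that]
    then have 1: "s * 1 \<le> s * (R * s)" using s0 by (intro mult_left_mono) auto
    have 2: "R * s\<^sup>2 \<le> R\<^sup>2 * s\<^sup>2" "R * s ^ 3 \<le> R\<^sup>2 * s ^ 3" using R2 s0 by (auto intro: mult_right_mono)
    have 3: "s\<^sup>2 * 1 \<le> s\<^sup>2 * (R * s)" using Rs[OF that] by (intro mult_left_mono) auto
    have 4: "R * s\<^sup>2 * 1 \<le> R * s\<^sup>2 * (R * s)" using Rs[OF that] R1 by (intro mult_left_mono) auto
    show "s \<le> R\<^sup>2 * s\<^sup>2" using 1 2 by (simp add: power2_eq_square mult_ac)
    show "s\<^sup>2 \<le> R\<^sup>2 * s ^ 3" using 3 2 by (simp add: power_numeral_reduce mult_ac)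
    show "s \<le> R\<^sup>2 * s ^ 3" using 1 4 by (simp add: power_numeral_reduce mult_ac)
  qed
  have conv: "k * h (Suc i) = eps * k * s" "k / eps * (h (Suc i))\<^sup>2 = eps * k * s\<^sup>2"
    "k / eps ^ 2 * h (Suc i) ^ 3 = eps * k * s ^ 3"
    using eps_pos by (simp_all add: hs power2_eq_square power3_eq_cube)
  note raw = truncation_raw[OF i, folded k_def, unfolded conv]
  have ek: "0 \<le> eps * k" using eps_pos k0 by simp
  have m: "eps * k * p \<le> eps * k * q" if "p \<le> q" for p q using that ek by (rule mult_left_mono)
  have "\<bar>res i\<bar> \<le> 4 * (eps * k * (R\<^sup>2 * s\<^sup>2))"
  proof -
    have nn: "0 \<le> eps * k * (R\<^sup>2 * s\<^sup>2)" using ek by simp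
    consider "cen (Suc i)" | "\<not> cen i" "\<not> cen (Suc i)" | "cen i" "\<not> cen (Suc i)"
      using cen_Suc by blast
    then show ?thesis
      using raw(1-3) m[OF s2(1)] m[OF s32] m[OF up(1)] nn by cases linarith+
  qed
  then show "\<bar>res i\<bar> \<le> eps * P * (h (Suc i) / eps)\<^sup>2"
    by (simp add: P s_def[symmetric] mult_ac)
  assume u: "h i = h (Suc i)"
  have "\<bar>res i\<bar> \<le> 4 * (eps * k * (R\<^sup>2 * s ^ 3))"
  proof -
    have nn: "0 \<le> eps * k * (R\<^sup>2 * s ^ 3)" using ek s0 by simp
    consider "cen (Suc i)" | "\<not> cen i" "\<not> cen (Suc i)" | "cen i" "\<not> cen (Suc i)"
      using cen_Suc by blast
    then show ?thesis
      using raw(3) raw(4,5)[OF _ u] m[OF s2(2)] m[OF up(2)] m[OF up(3)] nn by cases linarith+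
  qed
  then show "\<bar>res i\<bar> \<le> eps * P * (h (Suc i) / eps) ^ 3"
    by (simp add: P s_def[symmetric] mult_ac)
qed

end

section \<open>Sums of residuals over the blocks of the mesh\<close>

lemma sum_inverse_square_le:
  fixes s :: real
  assumes "0 < s"
  shows "(\<Sum>j=1..m. s / (1 + real j * s)\<^sup>2) \<le> 1"
proof -
  have "(\<Sum>j=1..m. s / (1 + real j * s)\<^sup>2) \<le> 1 - 1 / (1 + real m * s)"
  proof (induction m)
    case (Suc m)
    define p where "p = 1 + real m * s"
    have p: "1 \<le> p" "1 + real (Suc m) * s = p + s" using assms by (simp_all add: p_def algebra_simps)
    \<comment> \<open>Bounding the term by \<open>1 / p - 1 / (p + s)\<close> makes the sum
      telescope, whatever the size of \<open>s\<close>.\<close>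
    have "s / (p + s)\<^sup>2 \<le> s / (p * (p + s))"
      using p assms by (intro divide_left_mono) (auto simp: power2_eq_square intro: mult_right_mono)
    also have "\<dots> = 1 / p - 1 / (p + s)" using p assms by (simp add: field_simps)
    finally show ?case using Suc p by (simp add: p_def[symmetric])
  qed simp
  also have "\<dots> \<le> 1" using assms by simp
  finally show ?thesis .
qed

context layer_problem
begin

text \<open>The power \<open>3 ^ 6\<close> comes from \<open>1 + 2 * s <= 3\<close> in a first row
  with \<open>s <= 1\<close>, and from \<open>1 + t + 2 * s <= 3 * (1 + t)\<close> in rows with
  \<open>s <= t\<close>. \<open>exp (32 / bmin)\<close> is \<open>power_mult_gauss_le\<close> with
  \<open>q = 8\<close>: six powers to absorb and two more for a summable decay.\<close>

definition "C_trunc = 4 * K0 * B\<^sup>2"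
definition "C_row1 = 2 * (Up - Um) + 5 * B * C1 + C_trunc * 3 ^ 6"
definition "C_block1 = C_row1 + C_trunc * 3 ^ 6 * exp (32 / bmin)"

lemma C_trunc_pos: "0 < C_trunc"
  using K0_ge_1 B_ge_1 by (simp add: C_trunc_def)

end

context layer_scheme
begin

text \<open>No Taylor expansion is made: each term of the row is \<open>O(eps)\<close> by itself.
  Diffusion is, since \<open>u\<close> is bounded and \<open>eps <= h 1\<close>; convection and
  reaction are by \<open>flux_decay\<close>, the lengths in the reaction being comparable to
  \<open>x 1\<close> and \<open>x 2\<close>.\<close>

lemma first_row_coarse:
  assumes "h 2 = h 1" "eps \<le> h 1"
  shows "\<bar>res 1\<bar> \<le> (2 * (Up - Um) + 5 * B * C1) * eps"
proof -
  have idx: "1 \<in> {1..N-1}" "1 \<in> {1..N}" "1 \<le> N" "2 \<le> N" using N_ge_4 by auto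
  define M where "M = B * C1 * eps"
  have x1: "x 1 = h 1" by (simp add: step_def x_0)
  have M0: "0 \<le> M" using B_ge_1 C1_ge_1 eps_pos by (simp add: M_def)
  have f1: "\<bar>x 1 * F (Z 1)\<bar> \<le> M"
    using flux_decay[OF x_range[OF idx(3)]] x_range[OF idx(3)] by (simp add: M_def Z_def abs_mult)
  have f2: "\<bar>x 2 * F (Z 2)\<bar> \<le> M"
    using flux_decay[OF x_range[OF idx(4)]] x_range[OF idx(4)] by (simp add: M_def Z_def abs_mult)
  have hp: "0 < h 1" using step_pos[OF idx(2)] .
  have x12: "x 1 \<le> x 2" using x_mono[of 1 2] idx by simp
  have f2': "\<bar>h 1 * F (Z 2)\<bar> \<le> M"
  proof -
    have "h 1 * \<bar>F (Z 2)\<bar> \<le> x 2 * \<bar>F (Z 2)\<bar>" using x12 x1 by (intro mult_right_mono) auto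
    then show ?thesis using f2 hp x12 x1 by (simp add: abs_mult)
  qed
  have d: "\<bar>eps\<^sup>2 * (Z j - Z k) / h 1\<bar> \<le> (Up - Um) * eps" if "j \<le> N" "k \<le> N" for j k
  proof -
    have "\<bar>Z j - Z k\<bar> \<le> Up - Um"
      using u_range[OF x_range[OF that(1)]] u_range[OF x_range[OF that(2)]] by (auto simp: Z_def)
    then have "eps * \<bar>Z j - Z k\<bar> * eps \<le> h 1 * (Up - Um) * eps"
      using assms(2) eps_pos by (intro mult_right_mono mult_mono) auto
    moreover have "\<bar>eps\<^sup>2 * (Z j - Z k) / h 1\<bar> = eps * \<bar>Z j - Z k\<bar> * eps / h 1"
      using hp by (simp add: abs_mult power2_eq_square)
    ultimately show ?thesis using hp by (simp add: pos_divide_le_eq mult_ac)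
  qed
  have ae: "\<bar>p + q\<bar> \<le> A + Q" if "\<bar>p\<bar> \<le> A" "\<bar>q\<bar> \<le> Q" for p q A Q :: real
    using that by linarith
  have e1: "\<bar>edge_flux (\<lambda>j. F (Z j)) Z 1\<bar> \<le> (Up - Um) * eps + M"
  proof -
    have "edge_flux (\<lambda>j. F (Z j)) Z 1 = eps\<^sup>2 * (Z 1 - Z 0) / h 1
        + (if cen 1 then x 1 * F (Z 1) / 2 else x 1 * F (Z 1))"
      by (simp add: edge_flux_def x_0)
    moreover have "\<bar>if cen 1 then x 1 * F (Z 1) / 2 else x 1 * F (Z 1)\<bar> \<le> M"
      using f1 M0 by auto
    ultimately show ?thesis using ae[OF d[of 1 0]] idx by simp
  qed
  have e2: "\<bar>edge_flux (\<lambda>j. F (Z j)) Z 2\<bar> \<le> (Up - Um) * eps + M"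
  proof -
    have "edge_flux (\<lambda>j. F (Z j)) Z 2 = eps\<^sup>2 * (Z 2 - Z 1) / h 1
        + (if cen 2 then (x 2 * F (Z 2) + x 1 * F (Z 1)) / 2 else x 2 * F (Z 2))"
      by (simp add: edge_flux_def assms(1))
    moreover have "\<bar>if cen 2 then (x 2 * F (Z 2) + x 1 * F (Z 1)) / 2 else x 2 * F (Z 2)\<bar> \<le> M"
      using ae[OF f2 f1] f2 by auto
    ultimately show ?thesis using ae[OF d[of 2 1]] idx by simp
  qed
  have r: "\<bar>reaction (\<lambda>j. F (Z j)) 1\<bar> \<le> 3 / 2 * M"
  proof (cases "cen 1")
    case True
    have "ch 1 * \<bar>F (Z 1)\<bar> \<le> 3 / 2 * x 1 * \<bar>F (Z 1)\<bar>"
      using chi_bounds(3)[OF idx(1)] assms(1) x1 by (intro mult_right_mono) (auto simp: numeral_2_eq_2)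
    then show ?thesis using True f1 chi_bounds(1)[OF idx(1)] x1 hp
      by (simp add: reaction_def abs_mult)
  next
    case False
    then show ?thesis using f1 f2' assms(1) M0 x1
      by (simp add: reaction_def numeral_2_eq_2 distrib_left abs_le_iff)
  qed
  have "\<bar>res 1\<bar> \<le> 2 * ((Up - Um) * eps) + 5 * M"
    using e1 e2 r M0 unfolding res_def scheme_def by (simp add: numeral_2_eq_2)
  then show ?thesis by (simp add: M_def algebra_simps)
qed

text \<open>With \<open>s = h 1 / eps\<close>, the crude bound suffices for \<open>s >= 1\<close>
  because then \<open>s^2 >= 1\<close>; for \<open>s <= 1\<close> the Taylor bound has a bounded
  polynomial factor and \<open>s^3 <= s^2\<close>.\<close>

lemma first_row:
  assumes "h 2 = h 1"
  shows "\<bar>res 1\<bar> \<le> C_row1 * (eps * (h 1 / eps)\<^sup>2)"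
proof -
  have idx: "1 \<in> {1..N-1}" "1 \<in> {1..N}" using N_ge_4 by auto
  define s where "s = h 1 / eps"
  have s0: "0 < s" using step_pos[OF idx(2)] eps_pos by (simp add: s_def)
  show ?thesis
  proof (cases "eps \<le> h 1")
    case True
    then have "1 \<le> s" using eps_pos by (simp add: s_def)
    then have "1 \<le> s\<^sup>2" by simp
    have "\<bar>res 1\<bar> \<le> (2 * (Up - Um) + 5 * B * C1) * eps" using first_row_coarse[OF assms True] .
    also have "\<dots> \<le> C_row1 * (eps * s\<^sup>2)"
      using \<open>1 \<le> s\<^sup>2\<close> eps_pos Um_less_Up B_ge_1 C1_ge_1 C_trunc_pos
      by (intro mult_mono) (auto simp: C_row1_def)
    finally show ?thesis by (simp add: s_def)
  next
    case False
    then have s1: "s \<le> 1" using eps_pos by (simp add: s_def)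
    have x2: "x (Suc 1) / eps = 2 * s"
      using assms x_0 eps_pos by (simp add: x_Suc s_def numeral_2_eq_2 field_simps)
    have "\<bar>res 1\<bar> \<le> eps * (C_trunc * (1 + x (Suc 1) / eps) ^ 6 * gauss (x 0)) * s ^ 3"
      using truncation_error(2)[OF idx(1)] assms by (simp add: numeral_2_eq_2 s_def C_trunc_def)
    also have "\<dots> = eps * (C_trunc * (1 + 2 * s) ^ 6) * s ^ 3"
      unfolding x2 by (simp add: gauss_def x_0)
    also have "\<dots> \<le> eps * (C_trunc * 3 ^ 6) * s\<^sup>2"
      using s0 s1 eps_pos C_trunc_pos
      by (intro mult_mono mult_left_mono power_mono power_decreasing) auto
    also have "\<dots> = (C_trunc * 3 ^ 6) * (eps * s\<^sup>2)" by simp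
    also have "\<dots> \<le> C_row1 * (eps * s\<^sup>2)"
      using eps_pos Um_less_Up B_ge_1 C1_ge_1 by (intro mult_right_mono) (auto simp: C_row1_def)
    finally show ?thesis by (simp add: s_def)
  qed
qed

text \<open>From the second row on, the stencil starts at \<open>t = j * s >= s\<close> in stretched
  units, so the Gaussian there absorbs the polynomial factor at the right end and leaves
  \<open>s / (1 + t)^2\<close>, whose sum is bounded uniformly in \<open>s\<close>.\<close>

lemma first_block:
  assumes m: "2 \<le> m" "m \<le> N" and x: "\<And>j. j \<le> m \<Longrightarrow> x j = real j * H"
  shows "(\<Sum>i=1..<m. \<bar>res i\<bar>) \<le> C_block1 * (eps * (H / eps)\<^sup>2)"
proof -
  define s where "s = H / eps"
  have step: "h i = H" if "i \<in> {1..m}" for i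
    using x[of i] x[of "i - 1"] that by (cases i) (auto simp: step_def algebra_simps)
  have h1: "h 1 = H" "h 2 = H" using step m by auto
  have s0: "0 < s" using step_pos[of 1] h1 m eps_pos by (simp add: s_def)
  define E where "E = C_trunc * 3 ^ 6 * exp (32 / bmin)"
  have row: "\<bar>res (Suc j)\<bar> \<le> E * (eps * s\<^sup>2) * (s / (1 + real j * s)\<^sup>2)" if j: "j \<in> {1..m-2}" for j
  proof -
    have i: "Suc j \<in> {1..N-1}" "j \<le> m" "Suc (Suc j) \<le> m" "Suc j \<in> {1..m}" "Suc (Suc j) \<in> {1..m}"
      using j m by auto
    define t where "t = real j * s"
    have ts: "s \<le> t" using j s0 by (simp add: t_def)
    have xj: "x j / eps = t" "x (Suc (Suc j)) / eps = t + 2 * s"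
      using x[OF i(2)] x[OF i(3)] by (simp_all add: t_def s_def algebra_simps add_divide_distrib)
    have "\<bar>res (Suc j)\<bar> \<le> eps * (C_trunc * (1 + (t + 2 * s)) ^ 6 * gauss (x j)) * s ^ 3"
      using truncation_error(2)[OF i(1)] step[OF i(4)] step[OF i(5)] xj
      by (simp add: s_def C_trunc_def)
    also have "\<dots> \<le> eps * (C_trunc * (3 ^ 6 * (exp (32 / bmin) / (1 + t)\<^sup>2))) * s ^ 3"
    proof -
      have "(1 + (t + 2 * s)) ^ 6 \<le> (3 * (1 + t)) ^ 6" using ts s0 by (intro power_mono) auto
      moreover have "(1 + t) ^ 6 * gauss (x j) \<le> exp (32 / bmin) / (1 + t)\<^sup>2"
      proof -
        have "(1 + t) ^ 8 * exp (- (bmin / 2 * t\<^sup>2)) \<le> exp ((real 8)\<^sup>2 / (4 * (bmin / 2)))"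
          using bmin_pos ts s0 by (intro power_mult_gauss_le) auto
        then have "(1 + t) ^ 6 * gauss (x j) * (1 + t)\<^sup>2 \<le> exp (32 / bmin)"
          by (simp add: gauss_def xj mult_ac flip: power_add)
        then show ?thesis using ts s0 by (simp add: pos_le_divide_eq)
      qed
      moreover have "a * g \<le> 3 ^ 6 * q" if "a \<le> (3 * c) ^ 6" "c ^ 6 * g \<le> q" "0 < g" for a c g q :: real
      proof -
        have "a * g \<le> (3 * c) ^ 6 * g" using that by (intro mult_right_mono) auto
        also have "\<dots> = 3 ^ 6 * (c ^ 6 * g)" by (simp only: power_mult_distrib mult.assoc)
        also have "\<dots> \<le> 3 ^ 6 * q" using that by (intro mult_left_mono) auto
        finally show ?thesis .
      qed
      ultimately have "(1 + (t + 2 * s)) ^ 6 * gauss (x j) \<le> 3 ^ 6 * (exp (32 / bmin) / (1 + t)\<^sup>2)"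
        using gauss_pos[of "x j"] by blast
      then show ?thesis unfolding mult.assoc[of C_trunc] using eps_pos C_trunc_pos s0
        by (intro mult_right_mono mult_left_mono) auto
    qed
    finally show ?thesis by (simp add: E_def t_def power_numeral_reduce mult_ac)
  qed
  have "(\<Sum>i=1..<m. \<bar>res i\<bar>) = \<bar>res 1\<bar> + (\<Sum>j=1..m-2. \<bar>res (Suc j)\<bar>)"
  proof -
    have "{1..<m} = insert 1 (Suc ` {1..m-2})"
    proof (intro equalityI subsetI)
      fix i assume "i \<in> {1..<m}"
      then have "i = 1 \<or> i = Suc (i - 1) \<and> i - 1 \<in> {1..m-2}" by auto
      then show "i \<in> insert 1 (Suc ` {1..m-2})" by blast
    qed (use m in auto)
    moreover have "1 \<notin> Suc ` {1..m-2}" by auto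
    ultimately have "(\<Sum>i=1..<m. \<bar>res i\<bar>) = \<bar>res 1\<bar> + (\<Sum>i\<in>Suc ` {1..m-2}. \<bar>res i\<bar>)"
      using sum.insert[of "Suc ` {1..m-2}" 1 "\<lambda>i. \<bar>res i\<bar>"]
      by (simp only: finite_imageI finite_atLeastAtMost simp_thms)
    then show ?thesis
      using sum.reindex[of Suc "{1..m-2}" "\<lambda>i. \<bar>res i\<bar>"]
      by (simp add: o_def del: image_Suc_atLeastAtMost)
  qed
  also have "\<bar>res 1\<bar> \<le> C_row1 * (eps * s\<^sup>2)" using first_row h1 by (simp add: s_def)
  also have "(\<Sum>j=1..m-2. \<bar>res (Suc j)\<bar>) \<le> (\<Sum>j=1..m-2. E * (eps * s\<^sup>2) * (s / (1 + real j * s)\<^sup>2))"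
    by (intro sum_mono row)
  also have "\<dots> = E * (eps * s\<^sup>2) * (\<Sum>j=1..m-2. s / (1 + real j * s)\<^sup>2)"
    by (simp add: sum_distrib_left)
  also have "\<dots> \<le> E * (eps * s\<^sup>2) * 1"
    using sum_inverse_square_le[OF s0] eps_pos C_trunc_pos by (intro mult_left_mono) (auto simp: E_def)
  finally show ?thesis by (simp add: C_block1_def E_def s_def algebra_simps)
qed

text \<open>Row \<open>p\<close> joins two blocks with possibly different steps and only has order
  \<open>s^2\<close>; its stencil reaches back into the preceding block, hence the Gaussian at
  \<open>t0 / 2\<close>. The other rows have order \<open>s^3\<close>, and
  \<open>m * s <= t1 / eps\<close> turns their number into the seventh power.\<close>

lemma later_block:
  assumes p: "1 \<le> p" "p + m \<le> N" "1 \<le> m"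
    and x: "\<And>j. j \<le> m \<Longrightarrow> x (p + j) = t0 + real j * H" and t1: "t1 = t0 + real m * H"
    and half: "t0 / 2 \<le> x (p - 1)" "0 \<le> t0"
  shows "(\<Sum>j<m. \<bar>res (p + j)\<bar>) \<le>
    C_trunc * (1 + t1 / eps) ^ 7 * gauss (t0 / 2) * (eps * (H / eps)\<^sup>2)"
proof -
  define s where "s = H / eps"
  define Q where "Q = C_trunc * (1 + t1 / eps) ^ 6 * gauss (t0 / 2)"
  have step: "h (Suc (p + j)) = H" if "j < m" for j
    using x[of j] x[of "Suc j"] that by (simp add: step_def algebra_simps)
  have s0: "0 < s" using step[of 0] step_pos[of "Suc p"] p eps_pos by (simp add: s_def)
  have H0: "0 < H" using s0 eps_pos by (simp add: s_def zero_less_divide_iff)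
  have t1': "t0 \<le> t1" "0 \<le> t1 / eps" using t1 half H0 eps_pos by simp_all
  have Q0: "0 \<le> Q" using C_trunc_pos gauss_pos[of "t0 / 2"] t1' by (simp add: Q_def)
  have P: "4 * K0 * B\<^sup>2 * (1 + x (Suc (p + j)) / eps) ^ 6 * gauss (x (p + j - 1)) \<le> Q" if j: "j < m" for j
  proof -
    have "x (Suc (p + j)) \<le> t1"
      using x[of "Suc j"] j H0 mult_right_mono[of "real (Suc j)" "real m" H] by (simp add: t1)
    moreover have "0 \<le> x (Suc (p + j))" using x_range[of "Suc (p + j)"] p j by simp
    moreover have "x (p - 1) \<le> x (p + j - 1)" using p j by (intro x_mono) auto
    with half(1) have "t0 / 2 \<le> x (p + j - 1)" by linarith
    ultimately show ?thesis unfolding Q_def C_trunc_def[symmetric]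
      using eps_pos C_trunc_pos gauss_pos half(2) t1'
      by (intro mult_mono power_mono gauss_antimono) (auto simp: divide_right_mono less_imp_le)
  qed
  have i: "p + j \<in> {1..N-1}" if "j < m" for j using that p by auto
  have row0: "\<bar>res p\<bar> \<le> eps * Q * s\<^sup>2"
  proof -
    have "\<bar>res p\<bar> \<le> eps * (4 * K0 * B\<^sup>2 * (1 + x (Suc p) / eps) ^ 6 * gauss (x (p - 1))) * s\<^sup>2"
      using truncation_error(1)[OF i[of 0]] step[of 0] p by (simp add: s_def)
    also have "\<dots> \<le> eps * Q * s\<^sup>2"
      using P[of 0] p eps_pos by (intro mult_right_mono mult_left_mono) auto
    finally show ?thesis .
  qed
  have row: "\<bar>res (p + j)\<bar> \<le> eps * Q * s ^ 3" if j: "j \<in> {1..<m}" for j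
  proof -
    have jm: "j < m" "h (p + j) = H" "h (Suc (p + j)) = H"
      using j step[of j] step[of "j - 1"] by auto
    have "\<bar>res (p + j)\<bar> \<le> eps * (4 * K0 * B\<^sup>2 * (1 + x (Suc (p + j)) / eps) ^ 6 * gauss (x (p + j - 1))) * s ^ 3"
      using truncation_error(2)[OF i[OF jm(1)]] jm(2,3) by (simp add: s_def)
    also have "\<dots> \<le> eps * Q * s ^ 3"
      using P[OF jm(1)] eps_pos s0 by (intro mult_right_mono mult_left_mono) auto
    finally show ?thesis .
  qed
  have "{..<m} = insert 0 {1..<m}" using p by auto
  then have "(\<Sum>j<m. \<bar>res (p + j)\<bar>) = \<bar>res p\<bar> + (\<Sum>j=1..<m. \<bar>res (p + j)\<bar>)" by simp
  also have "\<dots> \<le> eps * Q * s\<^sup>2 + (\<Sum>j=1..<m. eps * Q * s ^ 3)" by (intro add_mono sum_mono row0 row)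
  also have "\<dots> = eps * Q * s\<^sup>2 + real (m - 1) * (eps * Q * s ^ 3)" by simp
  also have "\<dots> \<le> eps * Q * s\<^sup>2 + real m * (eps * Q * s ^ 3)"
    using eps_pos Q0 s0 by (intro add_left_mono mult_right_mono) auto
  also have "\<dots> = eps * Q * s\<^sup>2 * (1 + real m * s)" by (simp add: algebra_simps power_numeral_reduce)
  also have "\<dots> \<le> eps * Q * s\<^sup>2 * (1 + t1 / eps)"
    using t1 half(2) eps_pos Q0 by (intro mult_left_mono) (auto simp: s_def divide_right_mono)
  also have "\<dots> = C_trunc * (1 + t1 / eps) ^ 7 * gauss (t0 / 2) * (eps * (H / eps)\<^sup>2)"
    by (simp add: Q_def s_def power_numeral_reduce)
  finally show ?thesis .
qed

end

subsection \<open>The mesh\<close>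

text \<open>At each of the \<open>k\<close> stages the argument is at least an exponential, hence
  positive, so the totality of \<open>ln\<close> does no harm.\<close>

lemma iter_ln_ge:
  assumes "(exp ^^ k) a \<le> lam"
  shows "a \<le> iter_ln k lam"
  using assms
proof (induction k arbitrary: lam)
  case (Suc k)
  have "0 < lam" using Suc.prems less_le_trans[OF exp_gt_zero, of "(exp ^^ k) a" lam] by simp
  then have "(exp ^^ k) a \<le> ln lam" using Suc.prems by (simp add: ln_ge_iff)
  from Suc.IH[OF this] show ?case by (simp add: iter_ln_def funpow_swap1)
qed (simp add: iter_ln_def)

lemma funpow_exp_pos: "0 < ((exp :: real \<Rightarrow> real) ^^ k) 1"
  by (cases k) auto

lemma sum_blocks:
  fixes r :: "nat \<Rightarrow> real" and M :: "nat \<Rightarrow> nat"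
  shows "(\<Sum>i<(\<Sum>m\<in>{1..<Suc n}. M m). r i) =
    (\<Sum>k\<in>{1..<Suc n}. \<Sum>j<M k. r ((\<Sum>m\<in>{1..<k}. M m) + j))"
proof (induction n)
  case (Suc n)
  have "sum r {..<a + d} = sum r {..<a} + (\<Sum>j<d. r (a + j))" for a d
    by (induction d) (simp_all add: add.assoc)
  then show ?case using Suc by simp
qed simp

text \<open>Mesh intervals are named by their right ends, so \<open>j\<close> starts at 1 here,
  whereas \<open>sum_blocks\<close> counts nodes from the left end of each block.\<close>

lemma block_decomposition:
  fixes M :: "nat \<Rightarrow> nat"
  assumes "i \<in> {1..(\<Sum>m\<in>{1..<Suc n}. M m)}"
  obtains k j where "k \<in> {1..n}" "j \<in> {1..M k}" "i = (\<Sum>m\<in>{1..<k}. M m) + j"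
  using assms
proof (induction n arbitrary: thesis)
  case (Suc n)
  show ?case
  proof (cases "i \<le> (\<Sum>m\<in>{1..<Suc n}. M m)")
    case True
    with Suc.prems(2) have "i \<in> {1..(\<Sum>m\<in>{1..<Suc n}. M m)}" by simp
    then obtain k j where "k \<in> {1..n}" "j \<in> {1..M k}" "i = (\<Sum>m\<in>{1..<k}. M m) + j"
      using Suc.IH by blast
    then show ?thesis using Suc.prems(1)[of k j] by simp
  next
    case False
    then show ?thesis
      using Suc.prems(2) by (intro Suc.prems(1)[of "Suc n" "i - (\<Sum>m\<in>{1..<Suc n}. M m)"]) auto
  qed
qed simp

text \<open>\<open>S_mesh\<close> alone yields a positive iterated logarithm, possibly below 1 when
  \<open>l = K\<close>. The bound by 1 makes all the iterates \<open>y j\<close>,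
  \<open>j <= l\<close>, at least 1, so that their powers can be compared.\<close>

locale log_mesh =
  fixes \<alpha> c eps :: real and l N :: nat and Nk :: "nat \<Rightarrow> nat" and x :: "nat \<Rightarrow> real"
  assumes mesh: "S_mesh \<alpha> l c eps N Nk x"
    and eps_pos: "0 < eps" and \<alpha>_pos: "0 < \<alpha>" and iter_ln_ge_1: "1 \<le> iter_ln l (1 / eps)"
begin

abbreviation "y j \<equiv> iter_ln j (1 / eps)"
abbreviation "t k \<equiv> transition_pt \<alpha> l eps k"
abbreviation "S k \<equiv> \<Sum>m\<in>{1..<k}. Nk m"

definition "A = max 1 \<alpha>"

definition "H k = (t k - t (k - 1)) / real (Nk k)"

lemma l_ge_1: "1 \<le> l"
  using mesh by (auto simp: S_mesh_def)

lemma y_Suc: "y (Suc j) = ln (y j)"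
  by (simp add: iter_ln_def)

lemma y_exp: "j < l \<Longrightarrow> y j = exp (y (Suc j))"
  using mesh by (auto simp: S_mesh_def is_log_depth_def y_Suc)

lemma y_ge_1: "j \<le> l \<Longrightarrow> 1 \<le> y j"
proof (induction "l - j" arbitrary: j)
  case 0
  then show ?case using iter_ln_ge_1 by simp
next
  case (Suc d)
  then have "1 \<le> y (Suc j)" "j < l" by auto
  then show ?case using y_exp[of j] by simp
qed

lemma t_0: "t 0 = 0"
  by (simp add: transition_pt_def)

lemma t_last: "t (Suc l) = 1"
  by (simp add: transition_pt_def)

lemma t_mid: "k \<in> {1..l} \<Longrightarrow> t k = \<alpha> * eps * y (Suc (l - k))"
  by (simp add: transition_pt_def)

lemma t_less: "k \<le> l \<Longrightarrow> t k < t (Suc k)"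
proof -
  assume k: "k \<le> l"
  consider "k = 0" | "k = l" | "k \<in> {1..l}" "k < l" using k by force
  then show "t k < t (Suc k)"
  proof cases
    case 1
    have "t (Suc 0) = \<alpha> * eps * y l" using t_mid[of 1] l_ge_1 by (simp add: Suc_diff_le)
    then show ?thesis using 1 t_0 \<alpha>_pos eps_pos y_ge_1[of l] by simp
  next
    case 2
    then show ?thesis using mesh t_last by (simp add: S_mesh_def)
  next
    case 3
    have "y (l - k) = exp (y (Suc (l - k)))" using 3 by (intro y_exp) auto
    then have "y (Suc (l - k)) < y (l - k)" using exp_ge_add_one_self[of "y (Suc (l - k))"] by linarith
    moreover have "Suc (l - Suc k) = l - k" using 3 by simp
    ultimately show ?thesis using t_mid[of k] t_mid[of "Suc k"] 3 \<alpha>_pos eps_pos by simp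
  qed
qed

lemma t_nonneg: "k \<le> Suc l \<Longrightarrow> 0 \<le> t k"
proof (induction k)
  case (Suc k)
  then show ?case using t_less[of k] by simp
qed (simp add: t_0)

text \<open>As \<open>y 0 = 1 / eps\<close>, the end point \<open>1 = eps * y 0\<close> continues
  the pattern of the transition points, with 1 in place of \<open>alpha\<close>; \<open>A\<close>
  covers both.\<close>

lemma t_le: "k \<in> {1..Suc l} \<Longrightarrow> t k \<le> A * eps * y (Suc l - k)"
proof -
  assume k: "k \<in> {1..Suc l}"
  show "t k \<le> A * eps * y (Suc l - k)"
  proof (cases "k = Suc l")
    case True
    then show ?thesis using t_last eps_pos by (simp add: A_def iter_ln_def)
  next
    case False
    then have "t k = \<alpha> * eps * y (Suc l - k)" using k t_mid[of k] by (simp add: Suc_diff_le)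
    also have "\<dots> \<le> A * eps * y (Suc l - k)"
    proof (intro mult_right_mono)
      have "1 \<le> y (Suc l - k)" using k by (intro y_ge_1) auto
      then show "0 \<le> y (Suc l - k)" by simp
    qed (use eps_pos in \<open>auto simp: A_def\<close>)
    finally show ?thesis .
  qed
qed

lemma Nk_ge_2: "k \<in> {1..Suc l} \<Longrightarrow> 2 \<le> Nk k"
  using mesh by (simp add: S_mesh_def)

lemma N_le: "k \<in> {1..Suc l} \<Longrightarrow> real N \<le> c * real (Nk k)"
  using mesh by (simp add: S_mesh_def)

lemma S_last: "S (Suc (Suc l)) = N"
  using mesh by (simp add: S_mesh_def atLeastLessThanSuc_atLeastAtMost)

lemma S_Suc: "1 \<le> k \<Longrightarrow> S (Suc k) = S k + Nk k"
  by simp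

lemma N_ge_4: "4 \<le> N"
proof -
  have "Nk 1 + Nk (Suc l) = sum Nk {1, Suc l}" using l_ge_1 by simp
  also have "\<dots> \<le> S (Suc (Suc l))" by (rule sum_mono2) auto
  finally show ?thesis using Nk_ge_2[of 1] Nk_ge_2[of "Suc l"] S_last by simp
qed

lemma x_eq: "k \<in> {1..Suc l} \<Longrightarrow> j \<le> Nk k \<Longrightarrow> x (S k + j) = t (k - 1) + real j * H k"
  using mesh by (auto simp: S_mesh_def H_def)

lemma t_eq: "k \<in> {1..Suc l} \<Longrightarrow> t k = t (k - 1) + real (Nk k) * H k"
  using Nk_ge_2[of k] by (simp add: H_def)

lemma H_pos: "k \<in> {1..Suc l} \<Longrightarrow> 0 < H k"
  using t_less[of "k - 1"] Nk_ge_2[of k] by (auto simp: H_def)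

lemma H_le: "k \<in> {1..Suc l} \<Longrightarrow> H k / eps \<le> c * A * y (Suc l - k) / real N"
proof -
  assume k: "k \<in> {1..Suc l}"
  have N: "0 < real N" "0 < real (Nk k)" using N_ge_4 Nk_ge_2[OF k] by auto
  have c: "0 < c" using N_le[OF k] N by (metis less_le_trans zero_less_mult_pos2)
  have "real N * H k \<le> c * real (Nk k) * H k" using N_le[OF k] H_pos[OF k] by (intro mult_right_mono) auto
  also have "\<dots> = c * (t k - t (k - 1))" using N by (simp add: H_def)
  also have "\<dots> \<le> c * t k" using t_nonneg[of "k - 1"] k c by (intro mult_left_mono) auto
  also have "\<dots> \<le> c * (A * eps * y (Suc l - k))" using t_le[OF k] c by (intro mult_left_mono) auto
  finally show ?thesis using N eps_pos by (simp add: field_simps)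
qed

lemma step_eq: "k \<in> {1..Suc l} \<Longrightarrow> j \<in> {1..Nk k} \<Longrightarrow> step x (S k + j) = H k"
proof -
  assume k: "k \<in> {1..Suc l}" "j \<in> {1..Nk k}"
  then obtain i where i: "j = Suc i" "i \<le> Nk k" by (cases j) auto
  then show "step x (S k + j) = H k"
    using x_eq[OF k(1), of j] x_eq[OF k(1), of i] k by (simp add: step_def algebra_simps)
qed

lemma x_0: "x 0 = 0"
  using x_eq[of 1 0] t_0 by simp

lemma x_N: "x N = 1"
proof -
  have "N = S (Suc l) + Nk (Suc l)" using S_last S_Suc[of "Suc l"] by simp
  then show ?thesis using x_eq[of "Suc l" "Nk (Suc l)"] t_eq[of "Suc l"] t_last by simp
qed

lemma step_pos: "i \<in> {1..N} \<Longrightarrow> 0 < step x i"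
proof -
  assume "i \<in> {1..N}"
  then have "i \<in> {1..S (Suc (Suc l))}" using S_last by simp
  then obtain k j where "k \<in> {1..Suc l}" "j \<in> {1..Nk k}" "i = S k + j"
    by (rule block_decomposition)
  then show ?thesis using step_eq H_pos by simp
qed

lemma last_steps: "step x N = step x (N - 1)"
proof -
  have k: "Suc l \<in> {1..Suc l}" by simp
  have "N = S (Suc l) + Nk (Suc l)" using S_last S_Suc[of "Suc l"] by simp
  moreover obtain j where j: "Nk (Suc l) = Suc (Suc j)"
    using Nk_ge_2[OF k] by (metis Suc_le_D numeral_2_eq_2 Suc_le_mono)
  ultimately have "N = S (Suc l) + Suc (Suc j)" "N - 1 = S (Suc l) + Suc j" by simp_all
  then show ?thesis using step_eq[OF k, of "Suc (Suc j)"] step_eq[OF k, of "Suc j"] j by simp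
qed

text \<open>The preceding block has at least two subintervals, so one step back from its right end
  stays in its right half.\<close>

lemma half_transition:
  assumes "k \<in> {2..Suc l}"
  shows "2 \<le> S k" "t (k - 1) / 2 \<le> x (S k - 1)"
proof -
  obtain k' where k': "k = Suc k'" "k' \<in> {1..Suc l}" using assms by (cases k) auto
  have "S k = S k' + Nk k'" using k' S_Suc[of k'] by simp
  then show "2 \<le> S k" using Nk_ge_2[OF k'(2)] by simp
  have "S k - 1 = S k' + (Nk k' - 1)" using \<open>S k = S k' + Nk k'\<close> Nk_ge_2[OF k'(2)] by simp
  then have x: "x (S k - 1) = t (k' - 1) + real (Nk k' - 1) * H k'" using x_eq[OF k'(2)] by simp
  have "real (Nk k') / 2 * H k' \<le> real (Nk k' - 1) * H k'"
    using Nk_ge_2[OF k'(2)] H_pos[OF k'(2)] by (intro mult_right_mono) auto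
  moreover have "0 \<le> t (k' - 1)" using k' by (intro t_nonneg) auto
  ultimately show "t (k - 1) / 2 \<le> x (S k - 1)" using x t_eq[OF k'(2)] k' by simp
qed

end

subsection \<open>Consistency and convergence\<close>

context layer_problem
begin

text \<open>The last factor is \<open>power_mult_gauss_ln_le\<close> with \<open>q = 9\<close> and
  \<open>m = bmin * alpha^2 / 8\<close>: seven powers come from
  \<open>1 + t k / eps <= 2 * A * w\<close>, two from the squared step, and the 8 from taking the
  Gaussian at half the transition point.\<close>

definition "C_block2 a c \<alpha> = C_trunc * (2 * a) ^ 7 * (c * a)\<^sup>2 * exp (162 / (bmin * \<alpha>\<^sup>2))"

definition "C_cons l c \<alpha> = C_block1 * (c * max 1 \<alpha>)\<^sup>2 + real l * C_block2 (max 1 \<alpha>) c \<alpha>"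

lemma C_block_nonneg: "0 \<le> C_block1" "1 \<le> a \<Longrightarrow> 0 \<le> C_block2 a c \<alpha>"
  using Um_less_Up B_ge_1 C1_ge_1 C_trunc_pos
  by (simp_all add: C_block1_def C_row1_def C_block2_def)

end

locale layer_log_mesh =
  layer_scheme b b1 b2 Um Up bmin bmax B eps N x u u1 u2 + log_mesh \<alpha> c eps l N Nk x
  for b b1 b2 Um Up bmin bmax B eps N x u u1 u2 \<alpha> c l Nk
begin

lemma first_block_error:
  "(\<Sum>i=1..<Nk 1. \<bar>res i\<bar>) \<le> C_block1 * (c * A)\<^sup>2 * (eps * (y l / real N)\<^sup>2)"
proof -
  have k: "1 \<in> {1..Suc l}" by simp
  have "Nk 1 \<le> (\<Sum>m\<in>{1..<Suc (Suc l)}. Nk m)" by (rule member_le_sum) auto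
  then have "Nk 1 \<le> N" using S_last by simp
  then have "(\<Sum>i=1..<Nk 1. \<bar>res i\<bar>) \<le> C_block1 * (eps * (H 1 / eps)\<^sup>2)"
    using x_eq[OF k] t_0 by (intro first_block Nk_ge_2[OF k]) auto
  also have "\<dots> \<le> C_block1 * (eps * (c * A * y l / real N)\<^sup>2)"
    using H_le[OF k] H_pos[OF k] eps_pos C_block_nonneg(1)
    by (intro mult_left_mono power_mono) auto
  finally show ?thesis by (simp add: power_mult_distrib power_divide mult_ac)
qed

text \<open>Both ends of the block are governed by one iterate \<open>w\<close>: the right end is at
  most \<open>A * eps * w\<close>, while the left end equals \<open>alpha * eps * ln w\<close>. The
  last block is included, with \<open>w = 1 / eps\<close>.\<close>

lemma later_block_error:
  assumes "k \<in> {2..Suc l}"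
  shows "(\<Sum>j<Nk k. \<bar>res (S k + j)\<bar>) \<le> C_block2 A c \<alpha> * (eps * (y l / real N)\<^sup>2)"
proof -
  have k: "k \<in> {1..Suc l}" using assms by auto
  define w where "w = y (Suc l - k)"
  have w: "1 \<le> w" unfolding w_def using assms by (intro y_ge_1) auto
  have yl: "1 \<le> (y l)\<^sup>2" using iter_ln_ge_1 by simp
  have A: "1 \<le> A" by (simp add: A_def)
  have tk: "t (k - 1) = \<alpha> * eps * ln w"
  proof -
    have "Suc (l - (k - 1)) = Suc (Suc l - k)" using assms by auto
    moreover have "k - 1 \<in> {1..l}" using assms by auto
    ultimately show ?thesis using t_mid[of "k - 1"] by (simp only: w_def y_Suc)
  qed
  have "S k + Nk k \<le> N"
  proof -
    have "S (Suc k) \<le> S (Suc (Suc l))" using assms by (intro sum_mono2) auto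
    then show ?thesis using S_last S_Suc[of k] k by simp
  qed
  then have "(\<Sum>j<Nk k. \<bar>res (S k + j)\<bar>) \<le>
      C_trunc * (1 + t k / eps) ^ 7 * gauss (t (k - 1) / 2) * (eps * (H k / eps)\<^sup>2)"
    using half_transition[OF assms] Nk_ge_2[OF k] t_nonneg[of "k - 1"] assms
    by (intro later_block x_eq[OF k] t_eq[OF k]) auto
  also have "\<dots> \<le> C_trunc * (2 * A * w) ^ 7 * gauss (t (k - 1) / 2) * (eps * (c * A * w / real N)\<^sup>2)"
  proof -
    have "t k / eps \<le> A * w" using t_le[OF k] eps_pos by (simp add: w_def pos_divide_le_eq mult_ac)
    moreover have "1 * 1 \<le> A * w" using A w by (intro mult_mono) auto
    ultimately have 1: "1 + t k / eps \<le> 2 * A * w" by simp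
    have 2: "H k / eps \<le> c * A * w / real N" using H_le[OF k] by (simp add: w_def)
    have "0 \<le> t k / eps" "0 \<le> H k / eps"
      using t_nonneg[of k] H_pos[OF k] eps_pos assms by auto
    then show ?thesis using 1 2 A w C_trunc_pos gauss_pos[of "t (k - 1) / 2"] eps_pos
      by (intro mult_mono mult_left_mono power_mono) auto
  qed
  also have "\<dots> = C_trunc * (2 * A) ^ 7 * (c * A)\<^sup>2 * (w ^ 9 * gauss (t (k - 1) / 2)) * (eps / (real N)\<^sup>2)"
    by (simp add: power_mult_distrib power_divide power_numeral_reduce mult_ac)
  also have "\<dots> \<le> C_block2 A c \<alpha> * (eps / (real N)\<^sup>2)"
  proof -
    have "gauss (t (k - 1) / 2) = exp (- (bmin * \<alpha>\<^sup>2 / 8 * (ln w)\<^sup>2))"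
      unfolding gauss_def tk using eps_pos by (simp add: power_mult_distrib power_divide)
    moreover have "w ^ 9 * exp (- (bmin * \<alpha>\<^sup>2 / 8 * (ln w)\<^sup>2)) \<le> exp ((real 9)\<^sup>2 / (4 * (bmin * \<alpha>\<^sup>2 / 8)))"
      using bmin_pos \<alpha>_pos w by (intro power_mult_gauss_ln_le) auto
    ultimately have "w ^ 9 * gauss (t (k - 1) / 2) \<le> exp (162 / (bmin * \<alpha>\<^sup>2))" by simp
    then show ?thesis unfolding C_block2_def
      using C_trunc_pos A eps_pos by (intro mult_right_mono mult_left_mono) auto
  qed
  \<comment> \<open>The block is actually \<open>O(eps / N^2)\<close>; \<open>1 <= y l\<close>
    weakens this to the common form.\<close>
  also have "\<dots> \<le> C_block2 A c \<alpha> * (eps * (y l / real N)\<^sup>2)"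
    using C_block_nonneg(2)[OF A] eps_pos yl
    by (intro mult_left_mono) (auto simp: power_divide divide_right_mono)
  finally show ?thesis .
qed

lemma consistency:
  "(\<Sum>i=1..N-1. \<bar>res i\<bar>) \<le> C_cons l c \<alpha> * (eps * (y l / real N)\<^sup>2)"
proof -
  define \<delta> where "\<delta> = eps * (y l / real N)\<^sup>2"
  \<comment> \<open>The blocks partition the nodes \<open>0, ..., N - 1\<close>, but the scheme has
    no row at node 0. A transition node opens the block on its right.\<close>
  define r where "r i = (if i = 0 then 0 else \<bar>res i\<bar>)" for i
  have "{..<N} = insert 0 {1..N-1}" using N_ge_4 by auto
  then have "(\<Sum>i=1..N-1. \<bar>res i\<bar>) = (\<Sum>i<N. r i)" by (simp add: r_def)
  also have "\<dots> = (\<Sum>k\<in>{1..<Suc (Suc l)}. \<Sum>j<Nk k. r (S k + j))"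
    using sum_blocks[of r Nk "Suc l"] unfolding S_last .
  also have "{1..<Suc (Suc l)} = insert 1 {2..Suc l}" by auto
  also have "(\<Sum>k\<in>insert 1 {2..Suc l}. \<Sum>j<Nk k. r (S k + j)) =
      (\<Sum>j<Nk 1. r j) + (\<Sum>k=2..Suc l. \<Sum>j<Nk k. r (S k + j))" by simp
  also have "(\<Sum>j<Nk 1. r j) = (\<Sum>i=1..<Nk 1. \<bar>res i\<bar>)"
  proof -
    have "{..<Nk 1} = insert 0 {1..<Nk 1}" using Nk_ge_2[of 1] by auto
    then show ?thesis by (simp add: r_def)
  qed
  also have "\<dots> \<le> C_block1 * (c * A)\<^sup>2 * \<delta>" using first_block_error by (simp add: \<delta>_def)
  also have "(\<Sum>k=2..Suc l. \<Sum>j<Nk k. r (S k + j)) \<le> (\<Sum>k=2..Suc l. C_block2 A c \<alpha> * \<delta>)"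
  proof (rule sum_mono)
    fix k assume k: "k \<in> {2..Suc l}"
    have "r (S k + j) = \<bar>res (S k + j)\<bar>" for j
    proof -
      have "S k + j \<noteq> 0" using half_transition(1)[OF k] by linarith
      then show ?thesis unfolding r_def by (simp only: if_False)
    qed
    then show "(\<Sum>j<Nk k. r (S k + j)) \<le> C_block2 A c \<alpha> * \<delta>"
      using later_block_error[OF k] by (simp add: \<delta>_def)
  qed
  also have "\<dots> = real l * C_block2 A c \<alpha> * \<delta>" by simp
  finally show ?thesis by (simp add: C_cons_def A_def \<delta>_def distrib_right)
qed

lemma error_bound:
  assumes w: "discrete_solution b bmax Um Up eps N x w"
  shows "H_norm bmax eps N x (\<lambda>i. w i - u (x i)) \<le>
    2 / bmin * C_cons l c \<alpha> * (eps * (y l / real N)\<^sup>2)"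
proof -
  define W where "W = extend_bc Um Up N w"
  have W: "W j \<in> {Um..Up}" if "j \<le> N" for j
    using w that Um_less_Up by (auto simp: W_def extend_bc_def discrete_solution_def)
  have Z: "Z j \<in> {Um..Up}" if "j \<le> N" for j
    using u_range[OF x_range[OF that]] by (simp add: Z_def)
  have bc: "W 0 = Z 0" "W N = Z N"
    using N_ge_4 by (simp_all add: W_def extend_bc_def Z_def x_0 x_N u_0 u_1)
  have "bmin / 2 * H_norm bmax eps N x (\<lambda>i. w i - u (x i)) = bmin / 2 * (\<Sum>i=1..N-1. ch i * \<bar>W i - Z i\<bar>)"
    unfolding H_norm_def by (auto simp: W_def extend_bc_def Z_def intro!: sum.cong)
  also have "\<dots> \<le> (\<Sum>i=1..N-1. \<bar>scheme (\<lambda>j. F (W j)) W i - scheme (\<lambda>j. F (Z j)) Z i\<bar>)"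
    by (rule stability[OF W Z bc])
  also have "\<dots> = (\<Sum>i=1..N-1. \<bar>res i\<bar>)"
  proof (rule sum.cong)
    fix i assume i: "i \<in> {1..N-1}"
    have "scheme (\<lambda>j. F (W j)) W i = 0"
      using chi_T_op[OF i, of w] w i by (simp add: W_def discrete_solution_def)
    then show "\<bar>scheme (\<lambda>j. F (W j)) W i - scheme (\<lambda>j. F (Z j)) Z i\<bar> = \<bar>res i\<bar>"
      by (simp add: res_def)
  qed simp
  also have "\<dots> \<le> C_cons l c \<alpha> * (eps * (y l / real N)\<^sup>2)" by (rule consistency)
  finally have "bmin / 2 * H_norm bmax eps N x (\<lambda>i. w i - u (x i)) \<le>
    C_cons l c \<alpha> * (eps * (y l / real N)\<^sup>2)" .
  moreover have "X \<le> 2 / bmin * K * D" if "bmin / 2 * X \<le> K * D" for X K D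
    using that bmin_pos by (simp add: field_simps)
  ultimately show ?thesis by blast
qed

end

theorem theorem2:
  fixes b :: "real \<Rightarrow> real" and Um Up bmin bmax \<alpha> c :: real and l :: nat
  assumes "Um < Up"
    and "Ck_on 3 b {Um..Up}"
    and "0 < bmin"
    and "\<forall>u\<in>{Um..Up}. bmin \<le> b u \<and> b u \<le> bmax"
    and "1 \<le> l"
    and "0 < \<alpha>"
    and "1 \<le> c"
  shows "\<exists>eps0 M :: real. 0 < eps0 \<and> eps0 < 1 \<and> 0 < M \<and>
    (\<forall>eps N Nk x u w.
       0 < eps \<and> eps \<le> eps0 \<and>
       S_mesh \<alpha> l c eps N Nk x \<and>
       bvp_solution b Um Up eps u \<and>
       discrete_solution b bmax Um Up eps N x w \<longrightarrow>
       H_norm bmax eps N x (\<lambda>i. w i - u (x i))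
         \<le> M * (eps * (iter_ln l (1 / eps) / real N)\<^sup>2))"
proof -
  obtain b1 b2 b3 where
    b: "\<And>v. v \<in> {Um..Up} \<Longrightarrow> (b has_real_derivative b1 v) (at v within {Um..Up})"
    and b1: "\<And>v. v \<in> {Um..Up} \<Longrightarrow> (b1 has_real_derivative b2 v) (at v within {Um..Up})"
    and b2: "\<And>v. v \<in> {Um..Up} \<Longrightarrow> (b2 has_real_derivative b3 v) (at v within {Um..Up})"
    using assms(2) unfolding numeral_3_eq_3 Ck_on.simps by blast
  have bounded: "\<exists>K. \<forall>v\<in>{Um..Up}. \<bar>g v\<bar> \<le> K"
    if "\<And>v. v \<in> {Um..Up} \<Longrightarrow> (g has_real_derivative g' v) (at v within {Um..Up})" for g g'
  proof -
    have "continuous_on {Um..Up} g" using that by (meson DERIV_continuous_on)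
    then have "bounded (g ` {Um..Up})"
      by (intro compact_imp_bounded compact_continuous_image compact_Icc)
    then show ?thesis by (auto simp: bounded_iff)
  qed
  obtain K1 where K1: "\<forall>v\<in>{Um..Up}. \<bar>b1 v\<bar> \<le> K1" using bounded[OF b1] by blast
  obtain K2 where K2: "\<forall>v\<in>{Um..Up}. \<bar>b2 v\<bar> \<le> K2" using bounded[OF b2] by blast
  define B where "B = max (max 1 bmax) (max K1 K2)"
  interpret layer_problem b b1 b2 Um Up bmin bmax B
    by unfold_locales (use assms b b1 K1 K2 in \<open>force simp: B_def le_max_iff_disj\<close>)+
  \<comment> \<open>The tower of exponentials makes \<open>iter_ln l (1 / eps)\<close> at least 1
    for \<open>eps <= eps0\<close>; the \<open>1 / 2\<close> secures
    \<open>eps0 < 1\<close>.\<close>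
  define eps0 where "eps0 = min (1 / 2) (1 / (exp ^^ l) (1 :: real))"
  \<comment> \<open>\<open>C_cons\<close> is only shown to be nonnegative, so 1 is added to make
    \<open>M\<close> positive.\<close>
  define M where "M = 2 / bmin * C_cons l c \<alpha> + 1"
  have M: "0 < M" "2 / bmin * C_cons l c \<alpha> \<le> M"
    using C_block_nonneg assms by (simp_all add: M_def C_cons_def add_nonneg_pos)
  have "H_norm bmax eps N x (\<lambda>i. w i - u (x i)) \<le> M * (eps * (iter_ln l (1 / eps) / real N)\<^sup>2)"
    if eps: "0 < eps" "eps \<le> eps0" and mesh: "S_mesh \<alpha> l c eps N Nk x"
      and sol: "bvp_solution b Um Up eps u" and w: "discrete_solution b bmax Um Up eps N x w"
    for eps N Nk x u w
  proof -
    have "(exp ^^ l) (1 :: real) \<le> 1 / eps"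
      using eps funpow_exp_pos[of l] by (simp add: eps0_def field_simps)
    then have "1 \<le> iter_ln l (1 / eps)" by (rule iter_ln_ge)
    then interpret log_mesh \<alpha> c eps l N Nk x
      using mesh eps assms by unfold_locales auto
    obtain u1 u2 where "\<And>s. s \<in> {0..1} \<Longrightarrow> (u has_real_derivative u1 s) (at s within {0..1})"
      "\<And>s. s \<in> {0..1} \<Longrightarrow> (u1 has_real_derivative u2 s) (at s within {0..1})"
      "\<And>s. s \<in> {0..1} \<Longrightarrow> eps\<^sup>2 * u2 s + s * b (u s) * u1 s = 0"
      using sol unfolding bvp_solution_def by blast
    then interpret layer_log_mesh b b1 b2 Um Up bmin bmax B eps N x u u1 u2 \<alpha> c l Nk
      using eps mesh sol N_ge_4 x_0 x_N step_pos last_steps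
      by unfold_locales (auto simp: eps0_def bvp_solution_def S_mesh_def)
    show ?thesis
      using error_bound[OF w] M(2) eps(1)
      by (elim order_trans) (intro mult_right_mono, auto)
  qed
  moreover have "0 < eps0" "eps0 < 1" using funpow_exp_pos[of l] by (auto simp: eps0_def)
  ultimately show ?thesis using M(1) by blast
qed

end
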